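(* Let $M,K,\ell,D,t,k$ be positive integers with $\ell\le D$ and $k\le K$, such that $n=(D-\ell)/t+1$ is an integer and $Kn\ge MD$. Let $w_{i,m}\in\mathbb{R}^{\ell}$ ($1\le i\le K$, $1\le m\le M$) be $MK$ random vectors whose $MK\ell$ entries are of the form $\frac{1}{\sqrt{M\ell}}$ times i.i.d. (sub-)Gaussian random variables with zero mean and unit variance. Let $W$ be the $Kn\times MD$ weight matrix of the single-layer CNN with filters $w_{i,m}$, stride $t$, $M$ channels and input length $D$ (defined in the context). Let $0<\delta_k<1$ and $0<\epsilon<1$. Then there is a positive constant $C$ (depending only on the distribution of the unscaled entries, not on $M,K,\ell,D,t,n,k,\delta_k,\epsilon$) such that, if $$\frac{M\ell^2}{D}\ \ge\ \frac{C}{\delta_k^2}\Big(k\big(\log K+\log n\big)-\log\epsilon\Big),$$ then with probability at least $1-\epsilon$ the $MD\times Kn$ matrix $W^T$ satisfies the model-RIP for the model $\mathcal{M}_k$ with parameter $\delta_k$, i.e. $$(1-\delta_k)\|z\|_2^2\le\|W^Tz\|_2^2\le(1+\delta_k)\|z\|_2^2\qquad\text{for all } z\in\mathcal{M}_k .$$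
   Context: CNN weight matrix: for filters $w_{i,m}\in\mathbb{R}^\ell$ with coordinates $w_{i,m}(0),\dots,w_{i,m}(\ell-1)$, let $w_{i,m}^j\in\mathbb{R}^D$ ($0\le j\le n-1$) be the filter shifted by $jt$: $w_{i,m}^j(p)=w_{i,m}(p-jt)$ if $jt\le p\le jt+\ell-1$, and $0$ for the other $p\in\{0,\dots,D-1\}$. The matrix $W\in\mathbb{R}^{Kn\times MD}$ has rows indexed by pairs $(i,j)$, $1\le i\le K$, $0\le j\le n-1$, where the row $(i,j)$ is the concatenation $[(w_{i,1}^j)^T,\dots,(w_{i,M}^j)^T]$. The rows are grouped into $K$ blocks (one for each $i$) of size $n$. Sparsity model: coordinates of $z\in\mathbb{R}^{Kn}$ are correspondingly divided into $K$ contiguous blocks of size $n$. $\mathcal{M}_k\subset\mathbb{R}^{Kn}$ is the set of model-$k$-sparse vectors: those having at most one non-zero entry in each block and at most $k$ non-zero entries in total (a union of $n^k\binom{K}{k}$ coordinate subspaces of dimension $k$). A mean-zero random variable $Z$ is sub-Gaussian if there is a constant $c$ with $\mathbb{E}\exp(sZ)\le\exp(s^2c^2)$ for all $s\in\mathbb{R}$.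
   Formalization: The degenerate case Kn=1 (W a 1×1 matrix) is excluded unless the entries are standard Gaussian, since the claim fails there for some sub-Gaussian laws (e.g. 0 w.p. 1/2, ±√2 w.p. 1/4 each); C is stated per underlying sample set, and the canonical product space's C serves all. *)

theory Defs
  imports "HOL-Probability.Probability" "Jordan_Normal_Form.Matrix"
begin

(* All indices are 0-based: filters i < K, channels m < M, shifts j < n, positions p < D. *)

definition shifted_filter :: "nat \<Rightarrow> nat \<Rightarrow> (nat \<Rightarrow> real) \<Rightarrow> nat \<Rightarrow> nat \<Rightarrow> real" where
  "shifted_filter l t v j p = (if j * t \<le> p \<and> p < j * t + l then v (p - j * t) else 0)"

(* The filter w i m has coordinates w i m 0, ..., w i m (l - 1).  Row (i, j) is stored at
   index i * n + j, and the entry for channel m and position p at column m * D + p. *)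
definition cnn_weight_matrix ::
  "nat \<Rightarrow> nat \<Rightarrow> nat \<Rightarrow> nat \<Rightarrow> nat \<Rightarrow> nat \<Rightarrow> (nat \<Rightarrow> nat \<Rightarrow> nat \<Rightarrow> real) \<Rightarrow> real mat" where
  "cnn_weight_matrix M K l D t n w =
     mat (K * n) (M * D)
       (\<lambda>(r, c). shifted_filter l t (w (r div n) (c div D)) (r mod n) (c mod D))"

definition model_sparse :: "nat \<Rightarrow> nat \<Rightarrow> nat \<Rightarrow> real Matrix.vec set" where
  "model_sparse K n k =
     {z \<in> carrier_vec (K * n).
        (\<forall>i<K. card {j. j < n \<and> vec_index z (i * n + j) \<noteq> 0} \<le> 1) \<and>
        card {r. r < K * n \<and> vec_index z r \<noteq> 0} \<le> k}"

definition norm2 :: "real Matrix.vec \<Rightarrow> real" where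
  "norm2 z = L2_set (vec_index z) {..<dim_vec z}"

definition model_RIP :: "real mat \<Rightarrow> real Matrix.vec set \<Rightarrow> real \<Rightarrow> bool" where
  "model_RIP A S \<delta> \<longleftrightarrow>
     (\<forall>z\<in>S. (1 - \<delta>) * (norm2 z)\<^sup>2 \<le> (norm2 (A *\<^sub>v z))\<^sup>2 \<and>
            (norm2 (A *\<^sub>v z))\<^sup>2 \<le> (1 + \<delta>) * (norm2 z)\<^sup>2)"

(* Integrability is required explicitly because the Bochner integral of a non-integrable
   function is 0.  The mean-zero condition is part of the notion. *)
definition sub_gaussian :: "'a measure \<Rightarrow> ('a \<Rightarrow> real) \<Rightarrow> bool" where
  "sub_gaussian N Z \<longleftrightarrow>
     integrable N Z \<and> (\<integral>\<omega>. Z \<omega> \<partial>N) = 0 \<and>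
     (\<exists>c. \<forall>s. integrable N (\<lambda>\<omega>. exp (s * Z \<omega>)) \<and>
              (\<integral>\<omega>. exp (s * Z \<omega>) \<partial>N) \<le> exp (s\<^sup>2 * c\<^sup>2))"

end

theory Submission
  imports Defs
begin

text \<open>For a fixed \<open>v\<close> with one active shift per block, the coordinates of \<open>W\<^sup>T v\<close> are
  sub-Gaussian and involve disjoint sets of filter entries, hence are independent; a Chernoff
  bound for their squares gives \<open>\<bar>\<parallel>W\<^sup>T v\<parallel>\<^sup>2 - \<parallel>v\<parallel>\<^sup>2\<bar> < \<delta> / 2\<close> outside an event of probability
  \<open>2 exp (- c \<delta>\<^sup>2 M l\<^sup>2 / D)\<close>. A union bound over at most \<open>(K n)\<^sup>k\<close> supports, and on each support
  over the at most \<open>(3 \<cdot> 2\<^sup>1\<^sup>6)\<^sup>k\<close> points of a scaled integer grid in the unit ball, reaches all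
  sparse vectors because a quadratic form is controlled by its values on the grid.\<close>

subsection \<open>Concentration of sums of squares\<close>

text \<open>The hypothesis offers \<open>k (log K + log n) - log \<epsilon>\<close> and no additive
  constant, so the numerical factors of the union bound must be paid out of
  \<open>k log (K n)\<close>. This works as soon as \<open>K * n \<ge> 2\<close>. For
  \<open>K * n = 1\<close> the claim can fail: the law with mass 1/2 at 0 and 1/4 at each of
  \<open>\<plusminus>sqrt 2\<close> is centred, bounded and of variance 1, yet its square is never
  within \<open>\<delta> < 1\<close> of 1, while the hypothesis holds for \<open>\<epsilon>\<close>
  close to 1. Hence the disjunction in the theorem, and a direct computation with the Gaussian
  density in that case.

  The block condition of the model is what makes the coordinates of \<open>W\<^sup>T v\<close>
  independent: two active shifts of one filter would put the same random entry into two different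
  coordinates.\<close>

lemma nn_integral_std_normal_exp_linear:
  "(\<integral>\<^sup>+g. ennreal (std_normal_density g * exp (s * g)) \<partial>lborel) = ennreal (exp (s\<^sup>2 / 2))"
proof -
  have "std_normal_density g * exp (s * g) = exp (s\<^sup>2 / 2) * normal_density s 1 g" for g
    by (simp add: normal_density_def mult_exp_exp power2_eq_square field_simps flip: exp_add)
  then have "(\<integral>\<^sup>+g. ennreal (std_normal_density g * exp (s * g)) \<partial>lborel)
      = (\<integral>\<^sup>+g. ennreal (exp (s\<^sup>2 / 2) * normal_density s 1 g) \<partial>lborel)"
    by simp
  also have "\<dots> = ennreal (\<integral>g. exp (s\<^sup>2 / 2) * normal_density s 1 g \<partial>lborel)"
    by (rule nn_integral_eq_integral) auto
  finally show ?thesis by simp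
qed

text \<open>The weight cancels half of the Gaussian exponent \<open>g\<^sup>2 / 2\<close>; what
  remains is the density of variance 2 up to normalisation.\<close>

lemma nn_integral_std_normal_exp_square:
  "(\<integral>\<^sup>+g. ennreal (std_normal_density g * exp (g\<^sup>2 / 4)) \<partial>lborel) = ennreal (sqrt 2)"
proof -
  have "std_normal_density g * exp (g\<^sup>2 / 4) = sqrt 2 * normal_density 0 (sqrt 2) g" for g
    by (simp add: normal_density_def real_sqrt_mult field_simps flip: exp_add)
  then have "(\<integral>\<^sup>+g. ennreal (std_normal_density g * exp (g\<^sup>2 / 4)) \<partial>lborel)
      = (\<integral>\<^sup>+g. ennreal (sqrt 2 * normal_density 0 (sqrt 2) g) \<partial>lborel)"
    by simp
  also have "\<dots> = ennreal (\<integral>g. sqrt 2 * normal_density 0 (sqrt 2) g \<partial>lborel)"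
    by (rule nn_integral_eq_integral) auto
  finally show ?thesis by simp
qed

text \<open>The linear term is kept exact because it vanishes in expectation for a centred variable;
  this makes the resulting mgf bound quadratic in the parameter.\<close>

lemma exp_le_second_order:
  "exp (u::real) \<le> 1 + u + u\<^sup>2 / 2 * exp \<bar>u\<bar>"
proof -
  obtain t where t: "\<bar>t\<bar> \<le> \<bar>u\<bar>"
      "exp u = (\<Sum>m<2. u ^ m / fact m) + exp t / fact 2 * u ^ 2"
    using Maclaurin_exp_le[of u 2] by blast
  have "exp t * u\<^sup>2 \<le> exp \<bar>u\<bar> * u\<^sup>2"
    using t(1) by (intro mult_right_mono) auto
  then show ?thesis
    using t(2) by (simp add: numeral_2_eq_2 field_simps)
qed

context prob_space
begin

text \<open>Writing \<open>exp (y\<^sup>2 / (8\<tau>))\<close> as a Gaussian average of \<open>exp (s g y)\<close> and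
  exchanging the integrals reduces the square to the moment generating function.\<close>

lemma sub_gaussian_exp_square:
  fixes Y :: "'a \<Rightarrow> real"
  assumes [measurable]: "Y \<in> borel_measurable M" and \<tau>: "0 < \<tau>"
    and int: "\<And>s. integrable M (\<lambda>\<omega>. exp (s * Y \<omega>))"
    and mgf: "\<And>s. expectation (\<lambda>\<omega>. exp (s * Y \<omega>)) \<le> exp (s\<^sup>2 * \<tau>)"
  shows "integrable M (\<lambda>\<omega>. exp ((Y \<omega>)\<^sup>2 / (8 * \<tau>)))"
    and "expectation (\<lambda>\<omega>. exp ((Y \<omega>)\<^sup>2 / (8 * \<tau>))) \<le> sqrt 2"
proof -
  \<comment> \<open>With this \<open>s\<close>, averaging \<open>exp (s * Y * g)\<close> over
    \<open>g\<close> gives \<open>exp (s\<^sup>2 * Y\<^sup>2 / 2)\<close>, which has the desired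
    exponent, while the mgf bound at \<open>s * g\<close> is \<open>exp (g\<^sup>2 / 4)\<close>,
    still integrable against the Gaussian.\<close>
  define s where "s = sqrt (1 / (4 * \<tau>))"
  have s2: "s\<^sup>2 = 1 / (4 * \<tau>)" using \<tau> by (simp add: s_def)
  interpret pair_sigma_finite M lborel ..
  have "(\<integral>\<^sup>+\<omega>. ennreal (exp ((Y \<omega>)\<^sup>2 / (8 * \<tau>))) \<partial>M)
      = (\<integral>\<^sup>+\<omega>. (\<integral>\<^sup>+g. ennreal (std_normal_density g * exp (s * Y \<omega> * g)) \<partial>lborel) \<partial>M)"
    by (simp add: nn_integral_std_normal_exp_linear power_mult_distrib s2)
  also have "\<dots> = (\<integral>\<^sup>+g. (\<integral>\<^sup>+\<omega>. ennreal (std_normal_density g * exp (s * Y \<omega> * g)) \<partial>M) \<partial>lborel)"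
    by (rule Fubini'[symmetric]) measurable
  also have "\<dots> = (\<integral>\<^sup>+g. ennreal (std_normal_density g) * (\<integral>\<^sup>+\<omega>. ennreal (exp ((s * g) * Y \<omega>)) \<partial>M) \<partial>lborel)"
    by (intro nn_integral_cong) (simp add: ennreal_mult' nn_integral_cmult mult_ac)
  also have "\<dots> \<le> (\<integral>\<^sup>+g. ennreal (std_normal_density g) * ennreal (exp (g\<^sup>2 / 4)) \<partial>lborel)"
  proof (intro nn_integral_mono mult_left_mono)
    fix g
    have "(\<integral>\<^sup>+\<omega>. ennreal (exp ((s * g) * Y \<omega>)) \<partial>M) = ennreal (expectation (\<lambda>\<omega>. exp ((s * g) * Y \<omega>)))"
      by (rule nn_integral_eq_integral[OF int]) auto
    also have "\<dots> \<le> ennreal (exp (g\<^sup>2 / 4))"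
      using mgf[of "s * g"] \<tau> by (intro ennreal_leI) (simp add: power_mult_distrib s2)
    finally show "(\<integral>\<^sup>+\<omega>. ennreal (exp ((s * g) * Y \<omega>)) \<partial>M) \<le> ennreal (exp (g\<^sup>2 / 4))" .
  qed auto
  also have "\<dots> = ennreal (sqrt 2)"
    using nn_integral_std_normal_exp_square by (simp add: ennreal_mult')
  finally have *: "(\<integral>\<^sup>+\<omega>. ennreal (exp ((Y \<omega>)\<^sup>2 / (8 * \<tau>))) \<partial>M) \<le> ennreal (sqrt 2)" .
  show I: "integrable M (\<lambda>\<omega>. exp ((Y \<omega>)\<^sup>2 / (8 * \<tau>)))"
  proof (rule integrableI_nonneg)
    show "(\<integral>\<^sup>+\<omega>. ennreal (exp ((Y \<omega>)\<^sup>2 / (8 * \<tau>))) \<partial>M) < \<infinity>"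
      using * by (rule le_less_trans) simp
  qed auto
  have "ennreal (expectation (\<lambda>\<omega>. exp ((Y \<omega>)\<^sup>2 / (8 * \<tau>)))) \<le> ennreal (sqrt 2)"
    using * nn_integral_eq_integral[OF I] by simp
  then show "expectation (\<lambda>\<omega>. exp ((Y \<omega>)\<^sup>2 / (8 * \<tau>))) \<le> sqrt 2"
    by simp
qed

text \<open>A centred square is only sub-exponential, so a bound of Gaussian type is available just
  for small \<open>\<theta>\<close>. Below the threshold \<open>1 / (16 * \<tau>)\<close>, the
  Taylor remainder factor \<open>exp \<bar>u\<bar>\<close> uses up half of the exponent in
  \<open>exp (Y\<^sup>2 / (8 * \<tau>))\<close>; the other half pays for the quadratic
  factor.\<close>

lemma sub_gaussian_square_mgf:
  fixes Y :: "'a \<Rightarrow> real"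
  assumes [measurable]: "Y \<in> borel_measurable M" and \<tau>: "0 < \<tau>"
    and int: "\<And>s. integrable M (\<lambda>\<omega>. exp (s * Y \<omega>))"
    and mgf: "\<And>s. expectation (\<lambda>\<omega>. exp (s * Y \<omega>)) \<le> exp (s\<^sup>2 * \<tau>)"
    and sq: "integrable M (\<lambda>\<omega>. (Y \<omega>)\<^sup>2)" "expectation (\<lambda>\<omega>. (Y \<omega>)\<^sup>2) = v" "v \<le> \<tau>"
    and lam: "\<bar>\<theta>\<bar> \<le> 1 / (16 * \<tau>)"
  shows "integrable M (\<lambda>\<omega>. exp (\<theta> * ((Y \<omega>)\<^sup>2 - v)))"
    and "expectation (\<lambda>\<omega>. exp (\<theta> * ((Y \<omega>)\<^sup>2 - v))) \<le> exp (1026 * \<theta>\<^sup>2 * \<tau>\<^sup>2)"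
proof -
  have v0: "0 \<le> v" unfolding sq(2)[symmetric] by (rule Bochner_Integration.integral_nonneg) simp
  note E = sub_gaussian_exp_square[OF assms(1-4)]
  have pt: "exp (\<theta> * (V - v)) \<le> 1 + \<theta> * (V - v) + 513 * \<theta>\<^sup>2 * \<tau>\<^sup>2 * exp (V / (8 * \<tau>))"
    if V: "0 \<le> V" for V
  proof -
    define u where "u = \<theta> * (V - v)"
    define a where "a = V / (16 * \<tau>)"
    have a0: "0 \<le> a" and Va: "V = 16 * \<tau> * a" using V \<tau> by (auto simp: a_def)
    have "(V - v)\<^sup>2 \<le> V\<^sup>2 + \<tau>\<^sup>2"
    proof -
      have "v\<^sup>2 \<le> \<tau>\<^sup>2" using v0 sq(3) by (intro power_mono) auto
      moreover have "0 \<le> V * v" using V v0 by simp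
      ultimately show ?thesis by (simp add: power2_diff)
    qed
    also have "\<dots> = \<tau>\<^sup>2 * (256 * a\<^sup>2 + 1)" by (simp add: Va power2_eq_square algebra_simps)
    \<comment> \<open>\<open>513 = 512 + 1\<close>: the Taylor term \<open>a\<^sup>2 / 2\<close> in
      \<open>512 * exp a\<close> covers \<open>256 * a\<^sup>2\<close>, and one more
      \<open>exp a\<close> covers 1. The final 1026 is twice this, with \<open>sqrt 2\<close>
      rounded up to 2.\<close>
    also have "\<dots> \<le> \<tau>\<^sup>2 * (513 * exp a)"
    proof (rule mult_left_mono)
      have "1 + a + a\<^sup>2 / 2 \<le> exp a" using exp_lower_Taylor_quadratic[OF a0] .
      with a0 zero_le_power2[of a] show "256 * a\<^sup>2 + 1 \<le> 513 * exp a" by linarith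
    qed simp
    finally have 1: "(V - v)\<^sup>2 \<le> \<tau>\<^sup>2 * (513 * exp a)" .
    have "\<bar>u\<bar> \<le> 1 / (16 * \<tau>) * (V + \<tau>)"
      unfolding u_def abs_mult using lam V v0 sq(3) \<tau> by (intro mult_mono) auto
    also have "\<dots> = a + 1 / 16" using \<tau> by (simp add: a_def field_simps)
    finally have "exp \<bar>u\<bar> \<le> exp (1/16) * exp a" by (simp flip: exp_add)
    also have "exp (1/16::real) \<le> 2"
      using exp_bound[of "1/16"] by (simp add: power2_eq_square)
    finally have 2: "exp \<bar>u\<bar> \<le> 2 * exp a" by simp
    have "u\<^sup>2 / 2 * exp \<bar>u\<bar> = \<theta>\<^sup>2 * ((V - v)\<^sup>2 / 2 * exp \<bar>u\<bar>)"
      by (simp add: u_def power_mult_distrib)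
    also have "\<dots> \<le> \<theta>\<^sup>2 * (\<tau>\<^sup>2 * (513 * exp a) / 2 * (2 * exp a))"
      using 1 2 by (intro mult_left_mono mult_mono divide_right_mono) auto
    also have "\<dots> = 513 * \<theta>\<^sup>2 * \<tau>\<^sup>2 * exp (V / (8 * \<tau>))"
      by (simp add: a_def flip: exp_add)
    finally show ?thesis using exp_le_second_order[of u] unfolding u_def by linarith
  qed
  have I: "integrable M (\<lambda>\<omega>. 1 + \<theta> * ((Y \<omega>)\<^sup>2 - v) + 513 * \<theta>\<^sup>2 * \<tau>\<^sup>2 * exp ((Y \<omega>)\<^sup>2 / (8 * \<tau>)))"
    using E(1) sq(1) by auto
  show J: "integrable M (\<lambda>\<omega>. exp (\<theta> * ((Y \<omega>)\<^sup>2 - v)))"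
  proof (rule Bochner_Integration.integrable_bound[OF I])
    show "AE \<omega> in M. norm (exp (\<theta> * ((Y \<omega>)\<^sup>2 - v)))
        \<le> norm (1 + \<theta> * ((Y \<omega>)\<^sup>2 - v) + 513 * \<theta>\<^sup>2 * \<tau>\<^sup>2 * exp ((Y \<omega>)\<^sup>2 / (8 * \<tau>)))"
    proof (rule AE_I2)
      fix \<omega>
      show "norm (exp (\<theta> * ((Y \<omega>)\<^sup>2 - v)))
        \<le> norm (1 + \<theta> * ((Y \<omega>)\<^sup>2 - v) + 513 * \<theta>\<^sup>2 * \<tau>\<^sup>2 * exp ((Y \<omega>)\<^sup>2 / (8 * \<tau>)))"
        using pt[of "(Y \<omega>)\<^sup>2"] exp_gt_zero[of "\<theta> * ((Y \<omega>)\<^sup>2 - v)"] by simp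
    qed
  qed measurable
  have "expectation (\<lambda>\<omega>. exp (\<theta> * ((Y \<omega>)\<^sup>2 - v)))
      \<le> expectation (\<lambda>\<omega>. 1 + \<theta> * ((Y \<omega>)\<^sup>2 - v) + 513 * \<theta>\<^sup>2 * \<tau>\<^sup>2 * exp ((Y \<omega>)\<^sup>2 / (8 * \<tau>)))"
    by (rule integral_mono[OF J I]) (use pt in auto)
  also have "\<dots> = 1 + 513 * \<theta>\<^sup>2 * \<tau>\<^sup>2 * expectation (\<lambda>\<omega>. exp ((Y \<omega>)\<^sup>2 / (8 * \<tau>)))"
    using E(1) sq by (simp add: prob_space)
  also have "\<dots> \<le> 1 + 513 * \<theta>\<^sup>2 * \<tau>\<^sup>2 * 2"
  proof -
    have "sqrt 2 \<le> (2::real)" using real_sqrt_le_mono[of 2 4] by simp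
    then show ?thesis using E(2) by (intro add_left_mono mult_left_mono) auto
  qed
  also have "\<dots> \<le> exp (1026 * \<theta>\<^sup>2 * \<tau>\<^sup>2)"
    using exp_ge_add_one_self[of "1026 * \<theta>\<^sup>2 * \<tau>\<^sup>2"] by (simp add: mult.assoc)
  finally show "expectation (\<lambda>\<omega>. exp (\<theta> * ((Y \<omega>)\<^sup>2 - v))) \<le> exp (1026 * \<theta>\<^sup>2 * \<tau>\<^sup>2)" .
qed

lemma indep_vars_sub_gaussian_sum:
  fixes X :: "'i \<Rightarrow> 'a \<Rightarrow> real"
  assumes I: "finite I" "indep_vars (\<lambda>_. borel) X I"
    and int: "\<And>i s. i \<in> I \<Longrightarrow> integrable M (\<lambda>\<omega>. exp (s * X i \<omega>))"
    and mgf: "\<And>i s. i \<in> I \<Longrightarrow> expectation (\<lambda>\<omega>. exp (s * X i \<omega>)) \<le> exp (s\<^sup>2 * b)"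
  shows "integrable M (\<lambda>\<omega>. exp (s * (\<Sum>i\<in>I. a i * X i \<omega>)))"
    and "expectation (\<lambda>\<omega>. exp (s * (\<Sum>i\<in>I. a i * X i \<omega>))) \<le> exp (s\<^sup>2 * (b * (\<Sum>i\<in>I. (a i)\<^sup>2)))"
proof -
  have eq: "exp (s * (\<Sum>i\<in>I. a i * X i \<omega>)) = (\<Prod>i\<in>I. exp ((s * a i) * X i \<omega>))" for \<omega>
    using I(1) by (simp add: sum_distrib_left exp_sum mult.assoc)
  have ind: "indep_vars (\<lambda>_. borel) (\<lambda>i \<omega>. exp ((s * a i) * X i \<omega>)) I"
    using indep_vars_compose2[OF I(2), of "\<lambda>i x. exp ((s * a i) * x)" "\<lambda>_. borel"] by simp
  show "integrable M (\<lambda>\<omega>. exp (s * (\<Sum>i\<in>I. a i * X i \<omega>)))"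
    unfolding eq by (rule indep_vars_integrable[OF I(1) ind int])
  have "expectation (\<lambda>\<omega>. exp (s * (\<Sum>i\<in>I. a i * X i \<omega>))) = (\<Prod>i\<in>I. expectation (\<lambda>\<omega>. exp ((s * a i) * X i \<omega>)))"
    unfolding eq by (rule indep_vars_lebesgue_integral[OF I(1) ind int])
  also have "\<dots> \<le> (\<Prod>i\<in>I. exp ((s * a i)\<^sup>2 * b))"
    using mgf by (intro prod_mono conjI integral_nonneg_AE) auto
  also have "\<dots> = exp (s\<^sup>2 * (b * (\<Sum>i\<in>I. (a i)\<^sup>2)))"
    using I(1) by (simp add: exp_sum sum_distrib_left power_mult_distrib mult_ac flip: exp_sum)
  finally show "expectation (\<lambda>\<omega>. exp (s * (\<Sum>i\<in>I. a i * X i \<omega>))) \<le> exp (s\<^sup>2 * (b * (\<Sum>i\<in>I. (a i)\<^sup>2)))" .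
qed

lemma indep_vars_square_sum:
  fixes X :: "'i \<Rightarrow> 'a \<Rightarrow> real"
  assumes I: "finite I" "indep_vars (\<lambda>_. borel) X I"
    and X1: "\<And>i. i \<in> I \<Longrightarrow> integrable M (X i)" "\<And>i. i \<in> I \<Longrightarrow> expectation (X i) = 0"
    and X2: "\<And>i. i \<in> I \<Longrightarrow> integrable M (\<lambda>\<omega>. (X i \<omega>)\<^sup>2)"
      "\<And>i. i \<in> I \<Longrightarrow> expectation (\<lambda>\<omega>. (X i \<omega>)\<^sup>2) = 1"
  shows "integrable M (\<lambda>\<omega>. (\<Sum>i\<in>I. a i * X i \<omega>)\<^sup>2)"
    and "expectation (\<lambda>\<omega>. (\<Sum>i\<in>I. a i * X i \<omega>)\<^sup>2) = (\<Sum>i\<in>I. (a i)\<^sup>2)"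
proof -
  have eq: "(\<Sum>i\<in>I. a i * X i \<omega>)\<^sup>2 = (\<Sum>i\<in>I. \<Sum>j\<in>I. a i * a j * (X i \<omega> * X j \<omega>))" for \<omega>
    by (simp add: power2_eq_square sum_product mult_ac)
  have ii: "integrable M (\<lambda>\<omega>. X i \<omega> * X j \<omega>) \<and>
      expectation (\<lambda>\<omega>. X i \<omega> * X j \<omega>) = (if i = j then 1 else 0)"
    if ij: "i \<in> I" "j \<in> I" for i j
  proof (cases "i = j")
    case True
    then show ?thesis using X2[of i] ij by (simp add: power2_eq_square)
  next
    case False
    \<comment> \<open>Pairwise independence is read off from the independence of \<open>X i\<close>
      and a sum, here over the singleton \<open>{j}\<close>.\<close>
    have ind: "indep_var borel (X i) borel (X j)"
      using indep_vars_sum[of "{j}" i X] indep_vars_subset[OF I(2), of "{i, j}"] ij False by simp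
    show ?thesis
      using indep_var_lebesgue_integral[OF ind] indep_var_integrable[OF ind] X1 ij False by simp
  qed
  show "integrable M (\<lambda>\<omega>. (\<Sum>i\<in>I. a i * X i \<omega>)\<^sup>2)"
    unfolding eq using ii by auto
  have "expectation (\<lambda>\<omega>. (\<Sum>i\<in>I. a i * X i \<omega>)\<^sup>2) = (\<Sum>i\<in>I. \<Sum>j\<in>I. a i * a j * (if i = j then 1 else 0))"
    unfolding eq using ii by (simp add: Bochner_Integration.integral_sum)
  also have "\<dots> = (\<Sum>i\<in>I. (a i)\<^sup>2)"
    using I(1) by (intro sum.cong) (auto simp: power2_eq_square if_distrib cong: if_cong)
  finally show "expectation (\<lambda>\<omega>. (\<Sum>i\<in>I. a i * X i \<omega>)\<^sup>2) = (\<Sum>i\<in>I. (a i)\<^sup>2)" .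
qed

text \<open>A single \<open>\<tau>\<close> serves all blocks, which costs a factor \<open>card P\<close> in the exponent; this is
  why \<open>M l\<^sup>2 / D\<close> rather than \<open>M l\<close> appears in the theorem.\<close>

lemma chaos_mgf:
  fixes X :: "'i \<Rightarrow> 'a \<Rightarrow> real" and J :: "'p \<Rightarrow> 'i set"
  assumes I: "finite I" "indep_vars (\<lambda>_. borel) X I"
    and P: "finite P" "\<And>p. p \<in> P \<Longrightarrow> J p \<subseteq> I" "disjoint_family_on J P"
    and X1: "\<And>i. i \<in> I \<Longrightarrow> integrable M (X i)" "\<And>i. i \<in> I \<Longrightarrow> expectation (X i) = 0"
    and X2: "\<And>i. i \<in> I \<Longrightarrow> integrable M (\<lambda>\<omega>. (X i \<omega>)\<^sup>2)"
      "\<And>i. i \<in> I \<Longrightarrow> expectation (\<lambda>\<omega>. (X i \<omega>)\<^sup>2) = 1"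
    and int: "\<And>i s. i \<in> I \<Longrightarrow> integrable M (\<lambda>\<omega>. exp (s * X i \<omega>))"
    and mgf: "\<And>i s. i \<in> I \<Longrightarrow> expectation (\<lambda>\<omega>. exp (s * X i \<omega>)) \<le> exp (s\<^sup>2 * b)"
    and b: "1 \<le> b" and \<tau>: "0 < \<tau>" "\<And>p. p \<in> P \<Longrightarrow> b * (\<Sum>i\<in>J p. (a i)\<^sup>2) \<le> \<tau>"
    and \<theta>: "\<bar>\<theta>\<bar> \<le> 1 / (16 * \<tau>)"
  shows "integrable M (\<lambda>\<omega>. exp (\<theta> * (\<Sum>p\<in>P. (\<Sum>i\<in>J p. a i * X i \<omega>)\<^sup>2 - (\<Sum>i\<in>J p. (a i)\<^sup>2))))"
    and "expectation (\<lambda>\<omega>. exp (\<theta> * (\<Sum>p\<in>P. (\<Sum>i\<in>J p. a i * X i \<omega>)\<^sup>2 - (\<Sum>i\<in>J p. (a i)\<^sup>2))))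
      \<le> exp (1026 * \<theta>\<^sup>2 * \<tau>\<^sup>2 * card P)"
proof -
  define F where "F p \<omega> = exp (\<theta> * ((\<Sum>i\<in>J p. a i * X i \<omega>)\<^sup>2 - (\<Sum>i\<in>J p. (a i)\<^sup>2)))" for p \<omega>
  have eq: "exp (\<theta> * (\<Sum>p\<in>P. (\<Sum>i\<in>J p. a i * X i \<omega>)\<^sup>2 - (\<Sum>i\<in>J p. (a i)\<^sup>2))) = (\<Prod>p\<in>P. F p \<omega>)" for \<omega>
    unfolding F_def using P(1) by (simp add: sum_distrib_left exp_sum)
  \<comment> \<open>Each \<open>F p\<close> is a measurable function of the subfamily indexed by
    \<open>J p\<close>, and subfamilies over disjoint index sets are independent.\<close>
  have "indep_vars (\<lambda>_. borel)
      (\<lambda>p \<omega>. (\<lambda>x. exp (\<theta> * ((\<Sum>i\<in>J p. a i * x i)\<^sup>2 - (\<Sum>i\<in>J p. (a i)\<^sup>2)))) (restrict (\<lambda>i. X i \<omega>) (J p))) P"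
    by (rule indep_vars_compose2[OF indep_vars_restrict[OF I(2) P(2,3)]]) measurable
  then have ind: "indep_vars (\<lambda>_. borel) F P"
    by (simp add: F_def[abs_def])
  have J: "integrable M (F p)" "expectation (F p) \<le> exp (1026 * \<theta>\<^sup>2 * \<tau>\<^sup>2)" if p: "p \<in> P" for p
  proof -
    note Jp = P(2)[OF p]
    have fin: "finite (J p)" using Jp I(1) by (rule finite_subset)
    have indp: "indep_vars (\<lambda>_. borel) X (J p)" by (rule indep_vars_subset[OF I(2) Jp])
    have mX: "X i \<in> borel_measurable M" if "i \<in> J p" for i
      using indp that by (auto simp: indep_vars_def2)
    have sg: "integrable M (\<lambda>\<omega>. exp (s * (\<Sum>i\<in>J p. a i * X i \<omega>)))"
      "expectation (\<lambda>\<omega>. exp (s * (\<Sum>i\<in>J p. a i * X i \<omega>))) \<le> exp (s\<^sup>2 * (b * (\<Sum>i\<in>J p. (a i)\<^sup>2)))" for s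
      using indep_vars_sub_gaussian_sum[OF fin indp int mgf] Jp by blast+
    have sg': "expectation (\<lambda>\<omega>. exp (s * (\<Sum>i\<in>J p. a i * X i \<omega>))) \<le> exp (s\<^sup>2 * \<tau>)" for s
    proof -
      have "s\<^sup>2 * (b * (\<Sum>i\<in>J p. (a i)\<^sup>2)) \<le> s\<^sup>2 * \<tau>"
        using \<tau>(2)[OF p] by (intro mult_left_mono) auto
      then show ?thesis using sg(2)[of s] by (meson exp_le_cancel_iff order_trans)
    qed
    have sq: "integrable M (\<lambda>\<omega>. (\<Sum>i\<in>J p. a i * X i \<omega>)\<^sup>2)"
      "expectation (\<lambda>\<omega>. (\<Sum>i\<in>J p. a i * X i \<omega>)\<^sup>2) = (\<Sum>i\<in>J p. (a i)\<^sup>2)"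
      using indep_vars_square_sum[OF fin indp X1 X2] Jp by blast+
    \<comment> \<open>\<open>1 \<le> b\<close> lets the same \<open>\<tau>\<close> bound both the
      mgf proxy and the second moment.\<close>
    have "(\<Sum>i\<in>J p. (a i)\<^sup>2) \<le> b * (\<Sum>i\<in>J p. (a i)\<^sup>2)"
      using b mult_right_mono[of 1 b "\<Sum>i\<in>J p. (a i)\<^sup>2"] by (simp add: sum_nonneg)
    then have le: "(\<Sum>i\<in>J p. (a i)\<^sup>2) \<le> \<tau>" using \<tau>(2)[OF p] by linarith
    have m: "(\<lambda>\<omega>. \<Sum>i\<in>J p. a i * X i \<omega>) \<in> borel_measurable M"
      using mX by measurable
    show "integrable M (F p)" "expectation (F p) \<le> exp (1026 * \<theta>\<^sup>2 * \<tau>\<^sup>2)"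
      unfolding F_def[abs_def] using sub_gaussian_square_mgf[OF m \<tau>(1) sg(1) sg' sq le \<theta>] by blast+
  qed
  show "integrable M (\<lambda>\<omega>. exp (\<theta> * (\<Sum>p\<in>P. (\<Sum>i\<in>J p. a i * X i \<omega>)\<^sup>2 - (\<Sum>i\<in>J p. (a i)\<^sup>2))))"
    unfolding eq by (rule indep_vars_integrable[OF P(1) ind J(1)])
  have "expectation (\<lambda>\<omega>. exp (\<theta> * (\<Sum>p\<in>P. (\<Sum>i\<in>J p. a i * X i \<omega>)\<^sup>2 - (\<Sum>i\<in>J p. (a i)\<^sup>2))))
      = (\<Prod>p\<in>P. expectation (F p))"
    unfolding eq by (rule indep_vars_lebesgue_integral[OF P(1) ind J(1)])
  also have "\<dots> \<le> (\<Prod>p\<in>P. exp (1026 * \<theta>\<^sup>2 * \<tau>\<^sup>2))"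
    using J(2) by (intro prod_mono conjI Bochner_Integration.integral_nonneg) (auto simp: F_def)
  also have "\<dots> = exp (1026 * \<theta>\<^sup>2 * \<tau>\<^sup>2 * card P)"
    by (simp add: exp_of_nat_mult mult.commute)
  finally show "expectation (\<lambda>\<omega>. exp (\<theta> * (\<Sum>p\<in>P. (\<Sum>i\<in>J p. a i * X i \<omega>)\<^sup>2 - (\<Sum>i\<in>J p. (a i)\<^sup>2))))
      \<le> exp (1026 * \<theta>\<^sup>2 * \<tau>\<^sup>2 * card P)" .
qed

lemma chernoff_bound:
  fixes Z :: "'a \<Rightarrow> real"
  assumes [measurable]: "Z \<in> borel_measurable M" and \<theta>: "0 < \<theta>"
    and int: "integrable M (\<lambda>\<omega>. exp (\<theta> * Z \<omega>))"
    and mgf: "expectation (\<lambda>\<omega>. exp (\<theta> * Z \<omega>)) \<le> exp c"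
  shows "prob {\<omega> \<in> space M. x \<le> Z \<omega>} \<le> exp (c - \<theta> * x)"
proof -
  have "prob {\<omega> \<in> space M. exp (\<theta> * Z \<omega>) \<ge> exp (\<theta> * x)}
      \<le> expectation (\<lambda>\<omega>. exp (\<theta> * Z \<omega>)) / exp (\<theta> * x)"
    by (rule integral_Markov_inequality_measure[OF int, where A = "{}"]) auto
  also have "\<dots> \<le> exp c / exp (\<theta> * x)"
    using mgf by (intro divide_right_mono) auto
  finally show ?thesis using \<theta> by (simp add: exp_diff)
qed

text \<open>The range of \<open>x\<close> is cut so that the unconstrained minimiser of the Chernoff
  exponent is admissible in \<open>chaos_mgf\<close>; the tail thus stays Gaussian in
  \<open>x\<close> instead of becoming exponential.\<close>

lemma chaos_concentration:
  fixes X :: "'i \<Rightarrow> 'a \<Rightarrow> real" and J :: "'p \<Rightarrow> 'i set"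
  assumes I: "finite I" "indep_vars (\<lambda>_. borel) X I"
    and P: "finite P" "\<And>p. p \<in> P \<Longrightarrow> J p \<subseteq> I" "disjoint_family_on J P"
    and X1: "\<And>i. i \<in> I \<Longrightarrow> integrable M (X i)" "\<And>i. i \<in> I \<Longrightarrow> expectation (X i) = 0"
    and X2: "\<And>i. i \<in> I \<Longrightarrow> integrable M (\<lambda>\<omega>. (X i \<omega>)\<^sup>2)"
      "\<And>i. i \<in> I \<Longrightarrow> expectation (\<lambda>\<omega>. (X i \<omega>)\<^sup>2) = 1"
    and int: "\<And>i s. i \<in> I \<Longrightarrow> integrable M (\<lambda>\<omega>. exp (s * X i \<omega>))"
    and mgf: "\<And>i s. i \<in> I \<Longrightarrow> expectation (\<lambda>\<omega>. exp (s * X i \<omega>)) \<le> exp (s\<^sup>2 * b)"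
    and b: "1 \<le> b" and \<tau>: "0 < \<tau>" "\<And>p. p \<in> P \<Longrightarrow> b * (\<Sum>i\<in>J p. (a i)\<^sup>2) \<le> \<tau>"
    and x: "0 < x" "x \<le> 128 * \<tau> * card P"
  shows "prob {\<omega> \<in> space M. x \<le> \<bar>\<Sum>p\<in>P. (\<Sum>i\<in>J p. a i * X i \<omega>)\<^sup>2 - (\<Sum>i\<in>J p. (a i)\<^sup>2)\<bar>}
    \<le> 2 * exp (- (x\<^sup>2 / (4104 * \<tau>\<^sup>2 * card P)))"
proof -
  define Q where "Q \<omega> = (\<Sum>p\<in>P. (\<Sum>i\<in>J p. a i * X i \<omega>)\<^sup>2 - (\<Sum>i\<in>J p. (a i)\<^sup>2))" for \<omega>
  define m where "m = real (card P)"
  have m: "0 < m" using x \<tau>(1) zero_less_mult_iff[of "128 * \<tau>" m] unfolding m_def by linarith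
  have mX: "X i \<in> borel_measurable M" if "i \<in> I" for i
    using I(2) that by (auto simp: indep_vars_def2)
  have mQ [measurable]: "Q \<in> borel_measurable M"
    unfolding Q_def[abs_def] using P(2) mX
    by (intro borel_measurable_sum borel_measurable_diff borel_measurable_power borel_measurable_times) auto
  \<comment> \<open>The minimiser of
    \<open>1026 * \<theta>\<^sup>2 * \<tau>\<^sup>2 * m - \<theta> * x\<close>. It is at most
    \<open>1 / (16 * \<tau>)\<close> because \<open>128 * 16 \<le> 2052\<close>, and the minimum
    produces \<open>4104 = 4 * 1026\<close>.\<close>
  define \<theta> where "\<theta> = x / (2052 * \<tau>\<^sup>2 * m)"
  have \<theta>: "0 < \<theta>" using x \<tau>(1) m by (simp add: \<theta>_def)
  have le: "\<theta> \<le> 1 / (16 * \<tau>)"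
  proof -
    have "0 < \<tau> * m" using m \<tau>(1) by simp
    moreover have "x \<le> 128 * (\<tau> * m)" using x(2) by (simp add: m_def)
    ultimately have "x * 16 \<le> 2052 * (\<tau> * m)" by linarith
    then have "x * (16 * \<tau>) \<le> 2052 * \<tau>\<^sup>2 * m"
      using mult_right_mono[of "x * 16" "2052 * (\<tau> * m)" \<tau>] \<tau>(1) by (simp add: power2_eq_square mult_ac)
    then show ?thesis unfolding \<theta>_def using \<tau>(1) m by (simp add: divide_le_eq le_divide_eq mult_ac)
  qed
  have ex: "1026 * \<theta>\<^sup>2 * \<tau>\<^sup>2 * m - \<theta> * x = - (x\<^sup>2 / (4104 * \<tau>\<^sup>2 * m))"
    unfolding \<theta>_def using \<tau>(1) m by (simp add: field_simps power2_eq_square)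
  have up: "prob {\<omega> \<in> space M. x \<le> Q \<omega>} \<le> exp (- (x\<^sup>2 / (4104 * \<tau>\<^sup>2 * m)))"
    unfolding ex[symmetric]
    by (rule chernoff_bound[OF mQ \<theta>])
       (use chaos_mgf[OF I P X1 X2 int mgf b \<tau>, of \<theta>] \<theta> le in \<open>auto simp: Q_def m_def\<close>)
  \<comment> \<open>The lower tail is the same estimate at \<open>- \<theta>\<close>, since
    \<open>chaos_mgf\<close> admits either sign.\<close>
  have lo: "prob {\<omega> \<in> space M. x \<le> - Q \<omega>} \<le> exp (- (x\<^sup>2 / (4104 * \<tau>\<^sup>2 * m)))"
    unfolding ex[symmetric]
    by (rule chernoff_bound[OF borel_measurable_uminus[OF mQ] \<theta>])
       (use chaos_mgf[OF I P X1 X2 int mgf b \<tau>, of "- \<theta>"] \<theta> le in \<open>auto simp: Q_def m_def\<close>)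
  have "prob {\<omega> \<in> space M. x \<le> \<bar>Q \<omega>\<bar>}
      = prob ({\<omega> \<in> space M. x \<le> Q \<omega>} \<union> {\<omega> \<in> space M. x \<le> - Q \<omega>})"
    by (intro arg_cong[where f = prob]) auto
  also have "\<dots> \<le> prob {\<omega> \<in> space M. x \<le> Q \<omega>} + prob {\<omega> \<in> space M. x \<le> - Q \<omega>}"
    by (rule measure_Un_le) measurable
  also have "\<dots> \<le> 2 * exp (- (x\<^sup>2 / (4104 * \<tau>\<^sup>2 * m)))"
    using up lo by simp
  finally show ?thesis unfolding Q_def m_def .
qed

end

subsection \<open>Quadratic forms on an integer grid\<close>

definition qform :: "'i set \<Rightarrow> ('i \<Rightarrow> 'i \<Rightarrow> real) \<Rightarrow> ('i \<Rightarrow> real) \<Rightarrow> real" where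
  "qform T A z = (\<Sum>r\<in>T. \<Sum>s\<in>T. A r s * z r * z s)"

text \<open>Polarisation; the free scale \<open>c\<close> serves to balance two vectors of different
  norm before the form is bounded on their combinations.\<close>

lemma qform_add_diff:
  assumes "\<And>r s. A r s = A s r"
  shows "qform T A (\<lambda>r. u r + c * v r) - qform T A (\<lambda>r. u r - c * v r)
    = 4 * c * (\<Sum>r\<in>T. \<Sum>s\<in>T. A r s * u r * v s)"
proof -
  have "(\<Sum>r\<in>T. \<Sum>s\<in>T. A r s * v r * u s) = (\<Sum>r\<in>T. \<Sum>s\<in>T. A r s * u r * v s)"
    by (subst sum.swap) (intro sum.cong refl, simp add: assms[of _ _] mult_ac)
  moreover have "qform T A (\<lambda>r. u r + c * v r) - qform T A (\<lambda>r. u r - c * v r)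
    = 2 * c * (\<Sum>r\<in>T. \<Sum>s\<in>T. A r s * u r * v s) + 2 * c * (\<Sum>r\<in>T. \<Sum>s\<in>T. A r s * v r * u s)"
    unfolding qform_def sum_subtractf[symmetric] sum_distrib_left sum.distrib[symmetric]
    by (intro sum.cong refl) (simp add: algebra_simps)
  ultimately show ?thesis by simp
qed

lemma qform_diff:
  assumes "\<And>r s. A r s = A s r"
  shows "qform T A z - qform T A x = (\<Sum>r\<in>T. \<Sum>s\<in>T. A r s * (z r - x r) * (z s + x s))"
proof -
  have "(\<Sum>r\<in>T. \<Sum>s\<in>T. A r s * z r * x s) = (\<Sum>r\<in>T. \<Sum>s\<in>T. A r s * x r * z s)"
    by (subst sum.swap) (intro sum.cong refl, simp add: assms[of _ _] mult_ac)
  moreover have "(\<Sum>r\<in>T. \<Sum>s\<in>T. A r s * (z r - x r) * (z s + x s))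
     = qform T A z - qform T A x + (\<Sum>r\<in>T. \<Sum>s\<in>T. A r s * z r * x s) - (\<Sum>r\<in>T. \<Sum>s\<in>T. A r s * x r * z s)"
    unfolding qform_def sum_subtractf[symmetric] sum.distrib[symmetric]
    by (intro sum.cong refl) (simp add: algebra_simps)
  ultimately show ?thesis by simp
qed

lemma qform_scale: "qform T A (\<lambda>r. c * z r) = c\<^sup>2 * qform T A z"
  unfolding qform_def sum_distrib_left by (intro sum.cong refl) (simp add: power2_eq_square)

text \<open>Deliberately crude: it only ensures that the set of values on the unit ball is bounded,
  so that its supremum is a genuine upper bound.\<close>

lemma qform_abs_bound:
  assumes "finite T" "(\<Sum>r\<in>T. (z r)\<^sup>2) \<le> 1"
  shows "\<bar>qform T A z\<bar> \<le> (\<Sum>r\<in>T. \<Sum>s\<in>T. \<bar>A r s\<bar>)"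
proof -
  have z: "\<bar>z r\<bar> \<le> 1" if "r \<in> T" for r
  proof -
    have "(z r)\<^sup>2 \<le> 1" using member_le_sum[OF that, of "\<lambda>r. (z r)\<^sup>2"] assms by simp
    then show ?thesis by (simp add: abs_square_le_1)
  qed
  have "\<bar>qform T A z\<bar> \<le> (\<Sum>r\<in>T. \<Sum>s\<in>T. \<bar>A r s * z r * z s\<bar>)"
    unfolding qform_def by (intro order_trans[OF sum_abs] sum_mono sum_abs)
  also have "\<dots> \<le> (\<Sum>r\<in>T. \<Sum>s\<in>T. \<bar>A r s\<bar>)"
  proof (intro sum_mono)
    fix r s assume "r \<in> T" "s \<in> T"
    then have "\<bar>z r\<bar> * \<bar>z s\<bar> \<le> 1" using z by (simp add: mult_le_one)
    then show "\<bar>A r s * z r * z s\<bar> \<le> \<bar>A r s\<bar>"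
      using mult_left_mono[of "\<bar>z r\<bar> * \<bar>z s\<bar>" 1 "\<bar>A r s\<bar>"] by (simp add: abs_mult mult_ac)
  qed
  finally show ?thesis .
qed

text \<open>With \<open>S\<close> the supremum of \<open>\<bar>q\<bar>\<close> over the unit ball and \<open>x\<close> obtained by rounding
  \<open>z\<close> towards zero to the grid of width \<open>1 / (4 \<surd>k)\<close>, polarisation bounds
  \<open>q z - q x = B (z - x) (z + x)\<close> by \<open>S / 2\<close>, so \<open>S \<le> \<delta> / 2 + S / 2\<close>.\<close>

lemma qform_grid_bound:
  fixes A :: "'i \<Rightarrow> 'i \<Rightarrow> real"
  assumes T: "finite T" "card T \<le> k" "0 < k"
    and sym: "\<And>r s. A r s = A s r"
    and grid: "\<And>a :: 'i \<Rightarrow> int. (\<And>r. r \<notin> T \<Longrightarrow> a r = 0) \<Longrightarrow> (\<Sum>r\<in>T. (a r)\<^sup>2) \<le> 16 * int k \<Longrightarrow>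
      \<bar>qform T A (\<lambda>r. of_int (a r) / (4 * sqrt k))\<bar> \<le> \<delta> / 2"
  shows "\<bar>qform T A z\<bar> \<le> \<delta> * (\<Sum>r\<in>T. (z r)\<^sup>2)"
proof -
  define Ball where "Ball = {z :: 'i \<Rightarrow> real. (\<Sum>r\<in>T. (z r)\<^sup>2) \<le> 1}"
  define S where "S = (SUP z\<in>Ball. \<bar>qform T A z\<bar>)"
  have bdd: "bdd_above ((\<lambda>z. \<bar>qform T A z\<bar>) ` Ball)"
    using qform_abs_bound[OF T(1)] by (auto simp: Ball_def intro!: bdd_aboveI2)
  have S: "\<bar>qform T A z\<bar> \<le> S * (\<Sum>r\<in>T. (z r)\<^sup>2)" for z
  proof (cases "(\<Sum>r\<in>T. (z r)\<^sup>2) = 0")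
    case True
    then have "\<forall>r\<in>T. z r = 0" using T(1) by (simp add: sum_nonneg_eq_0_iff)
    then show ?thesis using True by (simp add: qform_def)
  next
    case False
    define c where "c = sqrt (\<Sum>r\<in>T. (z r)\<^sup>2)"
    have c2: "c\<^sup>2 = (\<Sum>r\<in>T. (z r)\<^sup>2)" by (simp add: c_def sum_nonneg)
    with False have c0: "c \<noteq> 0" by auto
    have "(\<lambda>r. 1 / c * z r) \<in> Ball"
      using c0 by (simp add: Ball_def power_divide c2[symmetric] flip: sum_divide_distrib)
    then have "\<bar>qform T A (\<lambda>r. 1 / c * z r)\<bar> \<le> S"
      unfolding S_def using bdd by (rule cSUP_upper)
    then have "\<bar>qform T A z\<bar> / c\<^sup>2 \<le> S"
      unfolding qform_scale by (simp add: abs_mult power_divide)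
    then show ?thesis using c0 by (simp add: c2[symmetric] field_simps)
  qed
  have "\<bar>qform T A z\<bar> \<le> \<delta> / 2 + S / 2" if z: "z \<in> Ball" for z
  proof -
    \<comment> \<open>At most \<open>k\<close> coordinates, each off by at most
      \<open>1 / h\<close>, give a squared rounding error of at most
      \<open>k / h\<^sup>2 = 1 / 16\<close>.\<close>
    define h where "h = 4 * sqrt (real k)"
    have h: "0 < h" "h\<^sup>2 = 16 * real k" using T(3) by (auto simp: h_def power_mult_distrib)
    \<comment> \<open>Rounding to the nearest integer could leave the ball. Towards zero no
      coordinate grows in modulus, so \<open>a\<close> meets the norm condition of
      \<open>grid\<close>.\<close>
    define a where "a r = (if r \<in> T then (if 0 \<le> z r then \<lfloor>h * z r\<rfloor> else \<lceil>h * z r\<rceil>) else 0)" for r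
    define x where "x r = of_int (a r) / h" for r
    have round: "\<bar>of_int (a r)\<bar> \<le> h * \<bar>z r\<bar> \<and> \<bar>h * z r - of_int (a r)\<bar> \<le> 1" if r: "r \<in> T" for r
    proof (cases "0 \<le> z r")
      case True
      then have "0 \<le> h * z r" using h by simp
      with True r show ?thesis by (simp add: a_def) linarith
    next
      case False
      then have "h * z r \<le> 0" using h by (simp add: mult_le_0_iff)
      with False r show ?thesis by (simp add: a_def) linarith
    qed
    have ax: "\<bar>x r\<bar> \<le> \<bar>z r\<bar>" "\<bar>z r - x r\<bar> \<le> 1 / h" if r: "r \<in> T" for r
    proof -
      show "\<bar>x r\<bar> \<le> \<bar>z r\<bar>" using round[OF r] h by (simp add: x_def field_simps)
      have "\<bar>z r - x r\<bar> = \<bar>h * z r - of_int (a r)\<bar> / h"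
        using h by (simp add: x_def abs_divide[symmetric] field_simps)
      also have "\<dots> \<le> 1 / h" using round[OF r] h by (intro divide_right_mono) auto
      finally show "\<bar>z r - x r\<bar> \<le> 1 / h" .
    qed
    have x1: "(\<Sum>r\<in>T. (x r)\<^sup>2) \<le> 1"
    proof -
      have "(\<Sum>r\<in>T. (x r)\<^sup>2) \<le> (\<Sum>r\<in>T. (z r)\<^sup>2)"
        using ax(1) by (intro sum_mono) (simp add: abs_le_square_iff)
      then show ?thesis using z by (simp add: Ball_def)
    qed
    have "real_of_int (\<Sum>r\<in>T. (a r)\<^sup>2) = h\<^sup>2 * (\<Sum>r\<in>T. (x r)\<^sup>2)"
      using h(1) by (simp add: x_def sum_distrib_left power_divide)
    also have "\<dots> \<le> 16 * real k" using x1 T(3) by (simp add: h(2))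
    finally have "real_of_int (\<Sum>r\<in>T. (a r)\<^sup>2) \<le> real_of_int (16 * int k)" by simp
    then have "(\<Sum>r\<in>T. (a r)\<^sup>2) \<le> 16 * int k" unfolding of_int_le_iff .
    then have qx: "\<bar>qform T A x\<bar> \<le> \<delta> / 2"
      using grid[of a] by (simp add: x_def[abs_def] h_def a_def)
    define u where "u r = z r - x r" for r
    define v where "v r = z r + x r" for r
    have u2: "(\<Sum>r\<in>T. (u r)\<^sup>2) \<le> 1 / 16"
    proof -
      have "(\<Sum>r\<in>T. (u r)\<^sup>2) \<le> (\<Sum>r\<in>T. (1 / h)\<^sup>2)"
        using ax(2) h(1) by (intro sum_mono) (simp add: u_def abs_le_square_iff[symmetric])
      also have "\<dots> = real (card T) / (16 * real k)" by (simp add: power_divide h)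
      also have "\<dots> \<le> 1 / 16" using T(2,3) by (simp add: field_simps)
      finally show ?thesis .
    qed
    have v2: "(\<Sum>r\<in>T. (v r)\<^sup>2) \<le> 4"
    proof -
      have "(\<Sum>r\<in>T. (v r)\<^sup>2) \<le> (\<Sum>r\<in>T. 2 * (z r)\<^sup>2 + 2 * (x r)\<^sup>2)"
      proof (intro sum_mono)
        fix r
        have "0 \<le> (z r - x r)\<^sup>2" by simp
        then show "(v r)\<^sup>2 \<le> 2 * (z r)\<^sup>2 + 2 * (x r)\<^sup>2"
          by (simp add: v_def power2_eq_square algebra_simps)
      qed
      also have "\<dots> \<le> 4" using z x1 by (simp add: Ball_def sum.distrib flip: sum_distrib_left)
      finally show ?thesis .
    qed
    \<comment> \<open>The factor \<open>1/8\<close> matches the norm bounds \<open>1/4\<close> for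
      \<open>u\<close> and \<open>2\<close> for \<open>v\<close>: the two combinations have total
      squared norm at most \<open>1/8 + 1/8\<close>, and undoing the polarisation costs a factor
      2.\<close>
    have par: "(\<Sum>r\<in>T. (u r + 1/8 * v r)\<^sup>2) + (\<Sum>r\<in>T. (u r - 1/8 * v r)\<^sup>2)
        = 2 * (\<Sum>r\<in>T. (u r)\<^sup>2) + 1/32 * (\<Sum>r\<in>T. (v r)\<^sup>2)"
      unfolding sum_distrib_left sum.distrib[symmetric]
      by (intro sum.cong refl) (simp add: power2_eq_square algebra_simps)
    have S0: "0 \<le> S"
    proof -
      have "(\<lambda>_. 0) \<in> Ball" by (simp add: Ball_def)
      then show ?thesis unfolding S_def by (rule cSUP_upper2[OF bdd]) simp
    qed
    have "1/2 * (qform T A z - qform T A x)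
        = qform T A (\<lambda>r. u r + 1/8 * v r) - qform T A (\<lambda>r. u r - 1/8 * v r)"
      using qform_diff[of A T z x, OF sym] qform_add_diff[of A T u "1/8" v, OF sym]
      by (simp add: u_def v_def)
    then have "\<bar>1/2 * (qform T A z - qform T A x)\<bar> \<le> S * (\<Sum>r\<in>T. (u r + 1/8 * v r)\<^sup>2) + S * (\<Sum>r\<in>T. (u r - 1/8 * v r)\<^sup>2)"
      using S[of "\<lambda>r. u r + 1/8 * v r"] S[of "\<lambda>r. u r - 1/8 * v r"] by linarith
    also have "\<dots> = S * (2 * (\<Sum>r\<in>T. (u r)\<^sup>2) + 1/32 * (\<Sum>r\<in>T. (v r)\<^sup>2))"
      by (simp only: distrib_left[symmetric] par)
    also have "\<dots> \<le> S * (1 / 4)"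
      using u2 v2 S0 by (intro mult_left_mono) auto
    finally have "\<bar>qform T A z - qform T A x\<bar> \<le> S / 2"
      by (simp only: abs_mult) simp
    then show ?thesis using qx by linarith
  qed
  then have "S \<le> \<delta> / 2 + S / 2"
    unfolding S_def by (intro cSUP_least) (auto simp: Ball_def intro!: exI[of _ "\<lambda>_. 0"])
  then have "S \<le> \<delta>" by simp
  then have "S * (\<Sum>r\<in>T. (z r)\<^sup>2) \<le> \<delta> * (\<Sum>r\<in>T. (z r)\<^sup>2)"
    by (intro mult_right_mono) (simp_all add: sum_nonneg)
  with S[of z] show ?thesis by linarith
qed

section \<open>Counting grid points and supports\<close>

lemma sum_pow2_abs_le: "(\<Sum>j\<in>{- int m..int m}. (1/2::real) ^ nat \<bar>j\<bar>) \<le> 3 - 2 * (1/2) ^ m"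
\<comment> \<open>The subtracted remainder of the two-sided geometric series is what makes the
  induction close; the limit is 3.\<close>
proof (induction m)
  case (Suc m)
  have "{- int (Suc m)..int (Suc m)} = insert (- int (Suc m)) (insert (int (Suc m)) {- int m..int m})"
    by auto
  then have "(\<Sum>j\<in>{- int (Suc m)..int (Suc m)}. (1/2::real) ^ nat \<bar>j\<bar>)
      = 2 * (1/2) ^ Suc m + (\<Sum>j\<in>{- int m..int m}. (1/2::real) ^ nat \<bar>j\<bar>)"
    by (simp del: of_nat_Suc)
  with Suc show ?case by simp
qed simp

text \<open>After division by \<open>4 * sqrt k\<close> these are the grid points in the unit ball
  of the coordinate space of \<open>T\<close>. Fixing the value 0 outside \<open>T\<close> makes
  each of them determined by its restriction to \<open>T\<close>.\<close>

definition grid_points :: "'i set \<Rightarrow> nat \<Rightarrow> ('i \<Rightarrow> int) set" where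
  "grid_points T k = {a. (\<forall>r. r \<notin> T \<longrightarrow> a r = 0) \<and> (\<Sum>r\<in>T. (a r)\<^sup>2) \<le> 16 * int k}"

text \<open>Each grid point is counted with weight \<open>2 ^ (16 k - \<Sum>\<bar>a r\<bar>) \<ge> 1\<close>, which makes
  the sum factorise.\<close>

lemma card_grid_points:
  assumes T: "finite T" "card T \<le> k"
  shows "finite (grid_points T k)" and "real (card (grid_points T k)) \<le> (3 * 2 ^ 16) ^ k"
proof -
  define m where "m = 16 * k"
  define E where "E = PiE T (\<lambda>_. {- int m..int m})"
  have finE: "finite E" unfolding E_def using T(1) by (intro finite_PiE) auto
  \<comment> \<open>On integers this turns the Euclidean bound into the l1 bound
    \<open>16 * k\<close>, the origin of the base \<open>2 ^ 16\<close>.\<close>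
  have sq: "\<bar>j\<bar> \<le> j\<^sup>2" for j :: int
    using self_le_power[of "\<bar>j\<bar>" 2] by (cases "j = 0") auto
  have l1: "(\<Sum>r\<in>T. \<bar>a r\<bar>) \<le> int m" if "a \<in> grid_points T k" for a
  proof -
    have "(\<Sum>r\<in>T. \<bar>a r\<bar>) \<le> (\<Sum>r\<in>T. (a r)\<^sup>2)" by (intro sum_mono sq)
    then show ?thesis using that by (simp add: grid_points_def m_def)
  qed
  \<comment> \<open>Members of \<open>PiE\<close> are \<open>undefined\<close> outside
    \<open>T\<close>, grid points are 0 there; restriction passes injectively from the latter to the
    former.\<close>
  define G where "G = (\<lambda>a. restrict a T) ` grid_points T k"
  have inj: "inj_on (\<lambda>a. restrict a T) (grid_points T k)"
  proof (intro inj_onI ext)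
    fix a b r
    assume "a \<in> grid_points T k" "b \<in> grid_points T k" "restrict a T = restrict b T"
    then show "a r = b r"
      by (cases "r \<in> T") (auto simp: grid_points_def dest: fun_cong[of _ _ r])
  qed
  have GE: "G \<subseteq> E"
  proof
    fix g assume "g \<in> G"
    then obtain a where a: "a \<in> grid_points T k" "g = restrict a T" by (auto simp: G_def)
    have "\<bar>a r\<bar> \<le> int m" if "r \<in> T" for r
      using member_le_sum[OF that, of "\<lambda>r. \<bar>a r\<bar>"] l1[OF a(1)] T(1) by simp
    then show "g \<in> E" using a(2) by (auto simp: E_def PiE_iff abs_le_iff) (smt (verit))+
  qed
  have finG: "finite G" using GE finE by (rule finite_subset)
  then show "finite (grid_points T k)" unfolding G_def using inj by (simp only: finite_image_iff)
  have "real (card (grid_points T k)) = (\<Sum>g\<in>G. 1)"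
    unfolding G_def by (simp add: card_image[OF inj])
  also have "\<dots> \<le> (\<Sum>g\<in>G. 2 ^ m * (\<Prod>r\<in>T. (1/2) ^ nat \<bar>g r\<bar>))"
  proof (rule sum_mono)
    fix g assume "g \<in> G"
    then obtain a where a: "a \<in> grid_points T k" "g = restrict a T" by (auto simp: G_def)
    have "(\<Prod>r\<in>T. (1/2::real) ^ nat \<bar>g r\<bar>) = (1/2) ^ (\<Sum>r\<in>T. nat \<bar>a r\<bar>)"
      by (simp add: power_sum a(2))
    moreover have "(\<Sum>r\<in>T. nat \<bar>a r\<bar>) \<le> m"
    proof -
      have "int (\<Sum>r\<in>T. nat \<bar>a r\<bar>) \<le> int m" using l1[OF a(1)] by simp
      then show ?thesis by (simp only: of_nat_le_iff)
    qed
    then have "(1/2::real) ^ m \<le> (1/2) ^ (\<Sum>r\<in>T. nat \<bar>a r\<bar>)"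
      by (intro power_decreasing) auto
    ultimately have "2 ^ m * (1/2::real) ^ m \<le> 2 ^ m * (\<Prod>r\<in>T. (1/2) ^ nat \<bar>g r\<bar>)"
      by (intro mult_left_mono) auto
    then show "1 \<le> 2 ^ m * (\<Prod>r\<in>T. (1/2::real) ^ nat \<bar>g r\<bar>)"
      by (simp flip: power_mult_distrib)
  qed
  also have "\<dots> \<le> (\<Sum>g\<in>E. 2 ^ m * (\<Prod>r\<in>T. (1/2) ^ nat \<bar>g r\<bar>))"
    using GE finE by (intro sum_mono2) (auto intro!: mult_nonneg_nonneg prod_nonneg)
  also have "\<dots> = 2 ^ m * (\<Prod>r\<in>T. \<Sum>j\<in>{- int m..int m}. (1/2) ^ nat \<bar>j\<bar>)"
    unfolding E_def using T(1) by (subst prod_sum_PiE) (simp_all add: sum_distrib_left)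
  also have "\<dots> \<le> 2 ^ m * (\<Prod>r\<in>T. 3)"
  proof (intro mult_left_mono prod_mono conjI)
    show "(\<Sum>j\<in>{- int m..int m}. (1/2::real) ^ nat \<bar>j\<bar>) \<le> 3"
      by (rule order_trans[OF sum_pow2_abs_le]) simp
  qed (auto intro!: sum_nonneg)
  also have "\<dots> \<le> 2 ^ m * 3 ^ k" using T(2) by (simp add: power_increasing)
  also have "\<dots> = (3 * 2 ^ 16) ^ k" unfolding m_def power_mult power_mult_distrib by (rule mult.commute)
  finally show "real (card (grid_points T k)) \<le> (3 * 2 ^ 16) ^ k" .
qed

text \<open>Every such set is the image of a map from \<open>{..<k}\<close>: enumerate it and send
  surplus indices to one chosen element. Nonemptiness provides that element.\<close>

lemma card_nonempty_subsets_le: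
  assumes "finite A"
  shows "finite {T. T \<subseteq> A \<and> T \<noteq> {} \<and> card T \<le> k}"
    and "card {T. T \<subseteq> A \<and> T \<noteq> {} \<and> card T \<le> k} \<le> card A ^ k"
proof -
  show "finite {T. T \<subseteq> A \<and> T \<noteq> {} \<and> card T \<le> k}"
    by (rule finite_subset[of _ "Pow A"]) (use assms in auto)
  have sub: "{T. T \<subseteq> A \<and> T \<noteq> {} \<and> card T \<le> k} \<subseteq> (\<lambda>f. f ` {..<k}) ` ({..<k} \<rightarrow>\<^sub>E A)"
  proof
    fix T assume "T \<in> {T. T \<subseteq> A \<and> T \<noteq> {} \<and> card T \<le> k}"
    then have T: "T \<subseteq> A" "T \<noteq> {}" "card T \<le> k" by auto
    have fT: "finite T" using T(1) assms by (rule finite_subset)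
    obtain t where t: "t \<in> T" using T(2) by auto
    obtain e where e: "bij_betw e {..<card T} T"
      using ex_bij_betw_nat_finite[OF fT] by (auto simp: atLeast0LessThan)
    define f where "f = (\<lambda>i\<in>{..<k}. if i < card T then e i else t)"
    have im: "e ` {..<card T} = T" using e by (simp add: bij_betw_def)
    have "f ` {..<k} = T"
    proof
      show "f ` {..<k} \<subseteq> T" using im t by (auto simp: f_def)
      show "T \<subseteq> f ` {..<k}"
      proof
        fix y assume "y \<in> T"
        then obtain i where "i < card T" "y = e i" using im by auto
        then show "y \<in> f ` {..<k}" using T(3) by (intro image_eqI[of _ _ i]) (auto simp: f_def)
      qed
    qed
    moreover from this have "f \<in> {..<k} \<rightarrow>\<^sub>E A"
      using T(1) unfolding PiE_iff by (metis f_def imageI restrict_extensional subsetD)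
    ultimately show "T \<in> (\<lambda>f. f ` {..<k}) ` ({..<k} \<rightarrow>\<^sub>E A)" by blast
  qed
  have fin: "finite ({..<k} \<rightarrow>\<^sub>E A)" using assms by (intro finite_PiE) auto
  have "card {T. T \<subseteq> A \<and> T \<noteq> {} \<and> card T \<le> k} \<le> card ({..<k} \<rightarrow>\<^sub>E A)"
    using card_mono[OF finite_imageI[OF fin] sub] card_image_le[OF fin] by (rule order_trans)
  then show "card {T. T \<subseteq> A \<and> T \<noteq> {} \<and> card T \<le> k} \<le> card A ^ k"
    by (simp add: card_PiE)
qed

subsection \<open>The random weight matrix\<close>

lemma sum_lessThan_mult:
  fixes f :: "nat \<Rightarrow> 'a::comm_monoid_add"
  shows "(\<Sum>c<m * n. f c) = (\<Sum>i<m. \<Sum>j<n. f (i * n + j))"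
  by (simp add: sum.nat_group[symmetric] sum.atLeastLessThan_shift_0 atLeast0LessThan)

lemma mult_add_less_mult:
  fixes i j m n :: nat
  assumes "i < m" "j < n"
  shows "i * n + j < m * n"
proof -
  have "i * n + j < Suc i * n" using assms(2) by simp
  also have "\<dots> \<le> m * n" using assms(1) by (intro mult_right_mono) auto
  finally show ?thesis .
qed

text \<open>This is \<open>\<parallel>W\<^sup>T v\<parallel>\<^sup>2 -
  \<parallel>v\<parallel>\<^sup>2\<close>, with \<open>v\<close> a coefficient function instead of a
  vector so that scaled grid points can be inserted directly.\<close>

definition excess :: "real mat \<Rightarrow> (nat \<Rightarrow> real) \<Rightarrow> real" where
  "excess W v = (\<Sum>c<dim_col W. (\<Sum>r<dim_row W. W $$ (r, c) * v r)\<^sup>2) - (\<Sum>r<dim_row W. (v r)\<^sup>2)"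

lemma norm2_sq: "(norm2 z)\<^sup>2 = (\<Sum>r<dim_vec z. (vec_index z r)\<^sup>2)"
  by (simp add: norm2_def L2_set_def sum_nonneg)

lemma norm2_transpose_mult_sq:
  assumes "z \<in> carrier_vec (dim_row W)"
  shows "(norm2 (transpose_mat W *\<^sub>v z))\<^sup>2 = (\<Sum>c<dim_col W. (\<Sum>r<dim_row W. W $$ (r, c) * vec_index z r)\<^sup>2)"
proof -
  have "scalar_prod (col W c) z = (\<Sum>r<dim_row W. W $$ (r, c) * vec_index z r)" if "c < dim_col W" for c
    using assms that by (auto simp: scalar_prod_def atLeast0LessThan intro!: sum.cong)
  then show ?thesis by (auto simp: norm2_sq intro!: sum.cong)
qed

lemma excess_vec_index:
  assumes "z \<in> carrier_vec (dim_row W)"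
  shows "excess W (vec_index z) = (norm2 (transpose_mat W *\<^sub>v z))\<^sup>2 - (norm2 z)\<^sup>2"
  unfolding excess_def norm2_transpose_mult_sq[OF assms] using assms by (simp add: norm2_sq)

text \<open>On vectors supported in \<open>T\<close> the excess is the form of the principal
  submatrix of \<open>W W\<^sup>T - I\<close> on \<open>T\<close>, to which the grid bound
  applies.\<close>

lemma excess_eq_qform:
  assumes T: "T \<subseteq> {..<dim_row W}" "\<And>r. r \<in> {..<dim_row W} - T \<Longrightarrow> v r = 0"
  shows "excess W v = qform T (\<lambda>r s. (\<Sum>c<dim_col W. W $$ (r, c) * W $$ (s, c)) - (if r = s then 1 else 0)) v"
proof -
  have fT: "finite T" using T(1) finite_subset by blast
  have red: "(\<Sum>r<dim_row W. f r * v r) = (\<Sum>r\<in>T. f r * v r)" for f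
    using T by (intro sum.mono_neutral_right) auto
  have "qform T (\<lambda>r s. (\<Sum>c<dim_col W. W $$ (r, c) * W $$ (s, c)) - (if r = s then 1 else 0)) v
      = (\<Sum>r\<in>T. \<Sum>s\<in>T. \<Sum>c<dim_col W. (W $$ (r, c) * v r) * (W $$ (s, c) * v s))
        - (\<Sum>r\<in>T. \<Sum>s\<in>T. (if r = s then 1 else 0) * v r * v s)"
    unfolding qform_def sum_subtractf[symmetric]
    by (intro sum.cong refl) (simp add: sum_distrib_right sum_distrib_left algebra_simps)
  also have "(\<Sum>r\<in>T. \<Sum>s\<in>T. \<Sum>c<dim_col W. (W $$ (r, c) * v r) * (W $$ (s, c) * v s))
      = (\<Sum>c<dim_col W. (\<Sum>r\<in>T. W $$ (r, c) * v r)\<^sup>2)"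
  proof -
    have "(\<Sum>c<dim_col W. (\<Sum>r\<in>T. W $$ (r, c) * v r)\<^sup>2)
        = (\<Sum>c<dim_col W. \<Sum>r\<in>T. \<Sum>s\<in>T. (W $$ (r, c) * v r) * (W $$ (s, c) * v s))"
      by (simp add: power2_eq_square sum_product)
    also have "\<dots> = (\<Sum>r\<in>T. \<Sum>c<dim_col W. \<Sum>s\<in>T. (W $$ (r, c) * v r) * (W $$ (s, c) * v s))"
      by (rule sum.swap)
    also have "\<dots> = (\<Sum>r\<in>T. \<Sum>s\<in>T. \<Sum>c<dim_col W. (W $$ (r, c) * v r) * (W $$ (s, c) * v s))"
      by (rule sum.cong[OF refl], rule sum.swap)
    finally show ?thesis by (rule sym)
  qed
  also have "(\<Sum>r\<in>T. \<Sum>s\<in>T. (if r = s then 1 else 0) * v r * v s) = (\<Sum>r\<in>T. v r * v r)"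
    using fT by (intro sum.cong refl) (simp add: if_distrib[where f = "\<lambda>x. x * _"] cong: if_cong)
  finally show ?thesis
    by (simp add: excess_def red power2_eq_square)
qed

text \<open>The empty set is excluded to match \<open>card_nonempty_subsets_le\<close>; it is the
  support of the zero vector alone, where the RIP is trivial.\<close>

definition model_supports :: "nat \<Rightarrow> nat \<Rightarrow> nat \<Rightarrow> nat set set" where
  "model_supports K n k = {T. T \<subseteq> {..<K * n} \<and> T \<noteq> {} \<and> card T \<le> k \<and>
     (\<forall>i<K. card {j. j < n \<and> i * n + j \<in> T} \<le> 1)}"

text \<open>The deterministic half of the argument. The form depends on the support of
  \<open>z\<close>, but grid points on that support and \<open>z\<close> itself share it, since all
  of them vanish elsewhere.\<close>

lemma model_RIP_if_grid:
  assumes W: "W \<in> carrier_mat (K * n) m" and k: "0 < k"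
    and grid: "\<And>T a. T \<in> model_supports K n k \<Longrightarrow> a \<in> grid_points T k \<Longrightarrow>
      \<bar>excess W (\<lambda>r. of_int (a r) / (4 * sqrt k))\<bar> \<le> \<delta> / 2"
  shows "model_RIP (transpose_mat W) (model_sparse K n k) \<delta>"
  unfolding model_RIP_def
proof
  fix z assume z: "z \<in> model_sparse K n k"
  have dims: "dim_row W = K * n" "dim_col W = m" using W by auto
  have zc: "z \<in> carrier_vec (dim_row W)" using z dims by (simp add: model_sparse_def)
  define T where "T = {r. r < K * n \<and> vec_index z r \<noteq> 0}"
  have "\<bar>excess W (vec_index z)\<bar> \<le> \<delta> * (norm2 z)\<^sup>2"
  proof (cases "T = {}")
    case True
    then show ?thesis
      using excess_eq_qform[of "{}" W "vec_index z"] zc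
      by (auto simp: qform_def norm2_sq T_def dims)
  next
    case False
    define A where "A r s = (\<Sum>c<dim_col W. W $$ (r, c) * W $$ (s, c)) - (if r = s then 1 else 0)" for r s
    have T: "T \<in> model_supports K n k"
    proof -
      have "{j. j < n \<and> i * n + j \<in> T} = {j. j < n \<and> vec_index z (i * n + j) \<noteq> 0}" if "i < K" for i
        using mult_add_less_mult[OF that] by (auto simp: T_def)
      then show ?thesis
        using z False by (auto simp: model_supports_def model_sparse_def T_def)
    qed
    have ex: "excess W v = qform T A v" if "\<And>r. r \<in> {..<dim_row W} - T \<Longrightarrow> v r = 0" for v
      unfolding A_def[abs_def] using that by (intro excess_eq_qform) (auto simp: T_def dims)
    have "\<bar>qform T A (vec_index z)\<bar> \<le> \<delta> * (\<Sum>r\<in>T. (vec_index z r)\<^sup>2)"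
    proof (rule qform_grid_bound[where k = k])
      show "finite T" by (simp add: T_def)
      show "card T \<le> k" using T by (simp add: model_supports_def)
      show "A r s = A s r" for r s by (simp add: A_def mult.commute)
      show "\<bar>qform T A (\<lambda>r. real_of_int (a r) / (4 * sqrt (real k)))\<bar> \<le> \<delta> / 2"
        if "\<And>r. r \<notin> T \<Longrightarrow> a r = 0" "(\<Sum>r\<in>T. (a r)\<^sup>2) \<le> 16 * int k" for a
        using grid[OF T, of a] that ex[of "\<lambda>r. real_of_int (a r) / (4 * sqrt (real k))"]
        by (simp add: grid_points_def)
    qed (rule k)
    moreover have "(\<Sum>r\<in>T. (vec_index z r)\<^sup>2) = (norm2 z)\<^sup>2"
      unfolding norm2_sq using zc dims by (intro sum.mono_neutral_left) (auto simp: T_def)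
    moreover have "excess W (vec_index z) = qform T A (vec_index z)"
      by (rule ex) (auto simp: T_def dims)
    ultimately show ?thesis by simp
  qed
  then show "(1 - \<delta>) * (norm2 z)\<^sup>2 \<le> (norm2 (transpose_mat W *\<^sub>v z))\<^sup>2 \<and>
      (norm2 (transpose_mat W *\<^sub>v z))\<^sup>2 \<le> (1 + \<delta>) * (norm2 z)\<^sup>2"
    unfolding excess_vec_index[OF zc] by (simp add: abs_le_iff algebra_simps)
qed

text \<open>A crude count that forgets the block condition; its logarithm is exactly the term
  \<open>k (log K + log n)\<close> of the hypothesis.\<close>

lemma card_model_supports:
  "finite (model_supports K n k)" "card (model_supports K n k) \<le> (K * n) ^ k"
proof -
  have sub: "model_supports K n k \<subseteq> {T. T \<subseteq> {..<K * n} \<and> T \<noteq> {} \<and> card T \<le> k}"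
    by (auto simp: model_supports_def)
  note c = card_nonempty_subsets_le[of "{..<K * n}" k]
  show "finite (model_supports K n k)" using finite_subset[OF sub c(1)] by simp
  have "card (model_supports K n k) \<le> card {T. T \<subseteq> {..<K * n} \<and> T \<noteq> {} \<and> card T \<le> k}"
    by (rule card_mono[OF c(1) sub]) simp
  also have "\<dots> \<le> (K * n) ^ k" using c(2) by simp
  finally show "card (model_supports K n k) \<le> (K * n) ^ k" .
qed

section \<open>How the filter entries enter the coordinates of the product\<close>

definition random_cnn :: "nat \<Rightarrow> nat \<Rightarrow> nat \<Rightarrow> nat \<Rightarrow> nat \<Rightarrow> nat \<Rightarrow> (nat \<times> nat \<times> nat \<Rightarrow> real) \<Rightarrow> real mat" where
  "random_cnn M K l D t n x =
     cnn_weight_matrix M K l D t n (\<lambda>i m p. x (i, m, p) / sqrt (real M * real l))"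

lemma random_cnn_dim [simp]:
  "dim_row (random_cnn M K l D t n x) = K * n" "dim_col (random_cnn M K l D t n x) = M * D"
  by (simp_all add: random_cnn_def cnn_weight_matrix_def)

lemma random_cnn_index:
  assumes "i < K" "j < n" "m < M" "p < D"
  shows "random_cnn M K l D t n x $$ (i * n + j, m * D + p) =
    (if j * t \<le> p \<and> p < j * t + l then x (i, m, p - j * t) / sqrt (real M * real l) else 0)"
proof -
  have "i * n + j < K * n" "m * D + p < M * D"
    using assms by (simp_all add: mult_add_less_mult)
  then show ?thesis
    using assms by (simp add: random_cnn_def cnn_weight_matrix_def shifted_filter_def)
qed

text \<open>Since \<open>v\<close> has one active shift per block, distinct coordinates \<open>(m, p)\<close> of \<open>W\<^sup>T v\<close>
  involve disjoint sets of filter entries.\<close>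

definition active_entries :: "nat \<Rightarrow> nat \<Rightarrow> nat \<Rightarrow> (nat \<Rightarrow> nat) \<Rightarrow> nat \<times> nat \<Rightarrow> (nat \<times> nat \<times> nat) set" where
  "active_entries K l t s = (\<lambda>(m, p). (\<lambda>i. (i, m, p - s i * t)) ` {i. i < K \<and> s i * t \<le> p \<and> p < s i * t + l})"

text \<open>An active entry \<open>(i, m, q)\<close> determines its coordinate: the channel is
  \<open>m\<close> and the position is \<open>q + s i * t\<close>, the subtraction in
  \<open>active_entries\<close> being exact.\<close>

lemma disjoint_active_entries: "disjoint_family_on (active_entries K l t s) P"
  by (auto simp: disjoint_family_on_def active_entries_def)

lemma sum_active_entries:
  "(\<Sum>e\<in>active_entries K l t s (m, p). f e)
    = (\<Sum>i<K. if s i * t \<le> p \<and> p < s i * t + l then f (i, m, p - s i * t) else 0)"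
proof -
  have "(\<Sum>e\<in>active_entries K l t s (m, p). f e)
      = (\<Sum>i\<in>{i. i < K \<and> s i * t \<le> p \<and> p < s i * t + l}. f (i, m, p - s i * t))"
    unfolding active_entries_def by (simp add: sum.reindex inj_on_def)
  also have "\<dots> = (\<Sum>i\<in>{i\<in>{..<K}. s i * t \<le> p \<and> p < s i * t + l}. f (i, m, p - s i * t))"
    by (intro sum.cong) auto
  also have "\<dots> = (\<Sum>i<K. if s i * t \<le> p \<and> p < s i * t + l then f (i, m, p - s i * t) else 0)"
    by (rule sum.inter_filter) simp
  finally show ?thesis .
qed

lemma sum_block_single:
  fixes s :: "nat \<Rightarrow> nat" and g :: "nat \<Rightarrow> 'a::comm_monoid_add"
  assumes "\<And>i. i < K \<Longrightarrow> s i < n"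
    and g: "\<And>i j. i < K \<Longrightarrow> j < n \<Longrightarrow> j \<noteq> s i \<Longrightarrow> g (i * n + j) = 0"
  shows "(\<Sum>r<K * n. g r) = (\<Sum>i<K. g (i * n + s i))"
  unfolding sum_lessThan_mult
proof (rule sum.cong[OF refl])
  fix i assume i: "i \<in> {..<K}"
  have "(\<Sum>j<n. g (i * n + j)) = (\<Sum>j\<in>{s i}. g (i * n + j))"
    using assms i by (intro sum.mono_neutral_right) auto
  then show "(\<Sum>j<n. g (i * n + j)) = g (i * n + s i)" by simp
qed

text \<open>Placed at its shift, every filter covers exactly \<open>l\<close> positions in each of
  the \<open>M\<close> channels. The scaling \<open>1 / sqrt (M * l)\<close> therefore makes all
  squared coefficients add up to the squared norm of \<open>v\<close>, which can be subtracted
  coordinate by coordinate.\<close>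

lemma excess_random_cnn:
  fixes K :: nat
  assumes pos: "0 < M" "0 < l" and fit: "\<And>i. i < K \<Longrightarrow> s i < n \<and> s i * t + l \<le> D"
    and v: "\<And>i j. i < K \<Longrightarrow> j < n \<Longrightarrow> j \<noteq> s i \<Longrightarrow> v (i * n + j) = 0"
    and coef: "\<And>i m q. coef (i, m, q) = v (i * n + s i) / sqrt (real M * real l)"
  shows "excess (random_cnn M K l D t n x) v = (\<Sum>mp\<in>{..<M} \<times> {..<D}.
      (\<Sum>e\<in>active_entries K l t s mp. coef e * x e)\<^sup>2 - (\<Sum>e\<in>active_entries K l t s mp. (coef e)\<^sup>2))"
proof -
  note one = sum_block_single[of K s n]
  have row: "(\<Sum>r<K * n. random_cnn M K l D t n x $$ (r, m * D + p) * v r)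
      = (\<Sum>e\<in>active_entries K l t s (m, p). coef e * x e)" if mp: "m < M" "p < D" for m p
  proof -
    have "(\<Sum>r<K * n. random_cnn M K l D t n x $$ (r, m * D + p) * v r)
      = (\<Sum>i<K. random_cnn M K l D t n x $$ (i * n + s i, m * D + p) * v (i * n + s i))"
      using fit by (intro one) (auto simp: v)
    also have "\<dots> = (\<Sum>e\<in>active_entries K l t s (m, p). coef e * x e)"
      unfolding sum_active_entries
      using fit mp by (intro sum.cong refl) (auto simp: random_cnn_index coef)
    finally show ?thesis .
  qed
  have cnt: "(\<Sum>p<D. if s i * t \<le> p \<and> p < s i * t + l then y else 0) = real l * y"
    if "i < K" for i and y :: real
  proof -
    have "(\<Sum>p<D. if s i * t \<le> p \<and> p < s i * t + l then y else 0)
        = (\<Sum>p\<in>{p\<in>{..<D}. s i * t \<le> p \<and> p < s i * t + l}. y)"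
      by (rule sum.inter_filter[symmetric]) simp
    also have "{p\<in>{..<D}. s i * t \<le> p \<and> p < s i * t + l} = {s i * t..<s i * t + l}"
      using fit[OF that] by auto
    finally show ?thesis by simp
  qed
  have "(\<Sum>mp\<in>{..<M} \<times> {..<D}. \<Sum>e\<in>active_entries K l t s mp. (coef e)\<^sup>2)
      = (\<Sum>m<M. \<Sum>p<D. \<Sum>i<K. if s i * t \<le> p \<and> p < s i * t + l then (v (i * n + s i))\<^sup>2 / (real M * real l) else 0)"
    unfolding sum.cartesian_product' sum_active_entries
    by (intro sum.cong refl) (simp add: coef power_divide)
  also have "\<dots> = (\<Sum>m<M. \<Sum>i<K. real l * ((v (i * n + s i))\<^sup>2 / (real M * real l)))"
    by (rule sum.cong[OF refl], rule trans[OF sum.swap], rule sum.cong[OF refl]) (simp add: cnt)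
  also have "\<dots> = (\<Sum>r<K * n. (v r)\<^sup>2)"
    using pos fit v sum_block_single[of K s n "\<lambda>r. (v r)\<^sup>2"] by (simp add: sum_distrib_left)
  finally show "excess (random_cnn M K l D t n x) v = (\<Sum>mp\<in>{..<M} \<times> {..<D}.
      (\<Sum>e\<in>active_entries K l t s mp. coef e * x e)\<^sup>2 - (\<Sum>e\<in>active_entries K l t s mp. (coef e)\<^sup>2))"
    by (simp add: excess_def sum_subtractf sum_lessThan_mult[of _ M D] row sum.cartesian_product')
qed

section \<open>Tail bound, measurability and union bound\<close>

locale cnn_sample = prob_space N for N :: "'a measure" +
  fixes M K l D t n :: nat and b :: real and X :: "nat \<times> nat \<times> nat \<Rightarrow> 'a \<Rightarrow> real"
  assumes pos: "0 < M" "0 < K" "0 < l" "l \<le> D" "0 < n" and fit: "(n - 1) * t + l \<le> D"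
    and ind: "indep_vars (\<lambda>_. borel) X ({..<K} \<times> {..<M} \<times> {..<l})"
    and mean: "\<And>e. e \<in> {..<K} \<times> {..<M} \<times> {..<l} \<Longrightarrow> integrable N (X e)"
      "\<And>e. e \<in> {..<K} \<times> {..<M} \<times> {..<l} \<Longrightarrow> expectation (X e) = 0"
    and var: "\<And>e. e \<in> {..<K} \<times> {..<M} \<times> {..<l} \<Longrightarrow> integrable N (\<lambda>\<omega>. (X e \<omega>)\<^sup>2)"
      "\<And>e. e \<in> {..<K} \<times> {..<M} \<times> {..<l} \<Longrightarrow> expectation (\<lambda>\<omega>. (X e \<omega>)\<^sup>2) = 1"
    and mgf: "\<And>e s. e \<in> {..<K} \<times> {..<M} \<times> {..<l} \<Longrightarrow> integrable N (\<lambda>\<omega>. exp (s * X e \<omega>))"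
      "\<And>e s. e \<in> {..<K} \<times> {..<M} \<times> {..<l} \<Longrightarrow> expectation (\<lambda>\<omega>. exp (s * X e \<omega>)) \<le> exp (s\<^sup>2 * b)"
    and b: "1 \<le> b"
begin

definition W :: "'a \<Rightarrow> real mat" where
  "W \<omega> = random_cnn M K l D t n (\<lambda>e. X e \<omega>)"

lemma W_dim [simp]: "dim_row (W \<omega>) = K * n" "dim_col (W \<omega>) = M * D"
  by (simp_all add: W_def)

lemma X_measurable: "e \<in> {..<K} \<times> {..<M} \<times> {..<l} \<Longrightarrow> X e \<in> borel_measurable N"
  using ind by (auto simp: indep_vars_def2)

lemma W_index:
  assumes "r < K * n" "c < M * D"
  shows "W \<omega> $$ (r, c) = (if (r mod n) * t \<le> c mod D \<and> c mod D < (r mod n) * t + l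
    then X (r div n, c div D, c mod D - (r mod n) * t) \<omega> / sqrt (real M * real l) else 0)"
  using assms by (simp add: W_def random_cnn_def cnn_weight_matrix_def shifted_filter_def)

lemma W_index_measurable:
  assumes "r < K * n" "c < M * D"
  shows "(\<lambda>\<omega>. W \<omega> $$ (r, c)) \<in> borel_measurable N"
proof (cases "(r mod n) * t \<le> c mod D \<and> c mod D < (r mod n) * t + l")
  case True
  have "(r div n, c div D, c mod D - (r mod n) * t) \<in> {..<K} \<times> {..<M} \<times> {..<l}"
    using assms True pos by (auto simp: less_mult_imp_div_less)
  then show ?thesis
    unfolding W_index[OF assms] if_P[OF True]
    by (intro borel_measurable_divide X_measurable borel_measurable_const)
qed (simp only: W_index[OF assms] if_False borel_measurable_const)

lemma excess_W_measurable [measurable]: "(\<lambda>\<omega>. excess (W \<omega>) v) \<in> borel_measurable N"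
  unfolding excess_def W_dim
  by (intro borel_measurable_diff borel_measurable_sum borel_measurable_power
      borel_measurable_times W_index_measurable borel_measurable_const) auto

text \<open>Every coordinate has squared coefficients summing to at most \<open>1 / (M * l)\<close>,
  so \<open>\<tau> = b / (M * l)\<close> serves all \<open>M * D\<close> of them. With deviation
  \<open>\<delta> / 2\<close> the concentration exponent becomes the stated one, where
  \<open>16416 = 4 * 4104\<close>.\<close>

lemma excess_W_tail:
  assumes v: "\<And>i. i < K \<Longrightarrow> card {j. j < n \<and> v (i * n + j) \<noteq> 0} \<le> 1" "(\<Sum>r<K * n. (v r)\<^sup>2) \<le> 1"
    and \<delta>: "0 < \<delta>" "\<delta> < 1"
  shows "prob {\<omega> \<in> space N. \<delta> / 2 \<le> \<bar>excess (W \<omega>) v\<bar>}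
    \<le> 2 * exp (- (\<delta>\<^sup>2 * (real M * (real l)\<^sup>2 / real D) / (16416 * b\<^sup>2)))"
proof -
  \<comment> \<open>A block on which \<open>v\<close> vanishes still needs a shift; any one will do,
    and \<open>0 < n\<close> guarantees that there is one.\<close>
  have "\<exists>s<n. \<forall>j<n. j \<noteq> s \<longrightarrow> v (i * n + j) = 0" if i: "i < K" for i
  proof (cases "{j. j < n \<and> v (i * n + j) \<noteq> 0} = {}")
    case True
    then show ?thesis using pos(5) by auto
  next
    case False
    then obtain s where s: "s \<in> {j. j < n \<and> v (i * n + j) \<noteq> 0}" by blast
    have "{j. j < n \<and> v (i * n + j) \<noteq> 0} = {s}"
      using v(1)[OF i] s card_le_Suc0_iff_eq[of "{j. j < n \<and> v (i * n + j) \<noteq> 0}"] by auto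
    then show ?thesis using s by auto
  qed
  then obtain s where s: "\<And>i. i < K \<Longrightarrow> s i < n"
      "\<And>i j. i < K \<Longrightarrow> j < n \<Longrightarrow> j \<noteq> s i \<Longrightarrow> v (i * n + j) = 0"
    by metis
  have sfit: "s i < n \<and> s i * t + l \<le> D" if "i < K" for i
  proof -
    have "s i * t \<le> (n - 1) * t" using s(1)[OF that] by (intro mult_right_mono) auto
    then show ?thesis using fit s(1)[OF that] by linarith
  qed
  define coef where "coef = (\<lambda>(i, m :: nat, q :: nat). v (i * n + s i) / sqrt (real M * real l))"
  have coef: "coef (i, m, q) = v (i * n + s i) / sqrt (real M * real l)" for i m q
    by (simp add: coef_def)
  have ex: "excess (W \<omega>) v = (\<Sum>mp\<in>{..<M} \<times> {..<D}.
      (\<Sum>e\<in>active_entries K l t s mp. coef e * X e \<omega>)\<^sup>2 - (\<Sum>e\<in>active_entries K l t s mp. (coef e)\<^sup>2))" for \<omega>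
    unfolding W_def by (rule excess_random_cnn) (use pos sfit s(2) coef in auto)
  have ex2: "(\<Sum>r<K * n. (v r)\<^sup>2) = (\<Sum>i<K. (v (i * n + s i))\<^sup>2)"
    by (rule sum_block_single) (use s in auto)
  define \<tau> where "\<tau> = b / (real M * real l)"
  have \<tau>0: "0 < \<tau>" using pos b by (simp add: \<tau>_def)
  define P where "P = {..<M} \<times> {..<D}"
  have cP: "card P = M * D" by (simp add: P_def)
  have "prob {\<omega> \<in> space N. \<delta> / 2 \<le> \<bar>\<Sum>mp\<in>P. (\<Sum>e\<in>active_entries K l t s mp. coef e * X e \<omega>)\<^sup>2
        - (\<Sum>e\<in>active_entries K l t s mp. (coef e)\<^sup>2)\<bar>}
      \<le> 2 * exp (- ((\<delta> / 2)\<^sup>2 / (4104 * \<tau>\<^sup>2 * card P)))"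
  proof (rule chaos_concentration[OF _ ind _ _ disjoint_active_entries mean var mgf b \<tau>0])
    show "active_entries K l t s mp \<subseteq> {..<K} \<times> {..<M} \<times> {..<l}" if "mp \<in> P" for mp
      using that by (auto simp: active_entries_def P_def)
    show "b * (\<Sum>e\<in>active_entries K l t s mp. (coef e)\<^sup>2) \<le> \<tau>" for mp
    proof (cases mp)
      case (Pair m p)
      have "(\<Sum>e\<in>active_entries K l t s (m, p). (coef e)\<^sup>2)
          \<le> (\<Sum>i<K. (v (i * n + s i))\<^sup>2 / (real M * real l))"
        unfolding sum_active_entries by (intro sum_mono) (auto simp: coef power_divide)
      also have "\<dots> = (\<Sum>r<K * n. (v r)\<^sup>2) / (real M * real l)"
        unfolding ex2 by (rule sum_divide_distrib[symmetric])
      also have "\<dots> \<le> 1 / (real M * real l)"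
        using v(2) by (intro divide_right_mono) auto
      finally show ?thesis
        using mult_left_mono[of _ "1 / (real M * real l)" b] b by (simp add: \<tau>_def Pair)
    qed
    \<comment> \<open>The admissible range is \<open>\<delta> / 2 \<le> 128 * b * D / l\<close>,
      comfortably implied by \<open>l \<le> D\<close> and \<open>1 \<le> b\<close>.\<close>
    have "real l \<le> real D * b" using pos(4) b mult_mono[of "real l" "real D" 1 b] by simp
    then have "\<delta> * real l \<le> 1 * (real D * b)" using \<delta> by (intro mult_mono) auto
    moreover have "0 \<le> real D * b" using b by simp
    ultimately have "\<delta> * real l \<le> 256 * (real D * b)" by linarith
    then show "\<delta> / 2 \<le> 128 * \<tau> * real (card P)"
      using pos by (simp add: \<tau>_def cP field_simps)
  qed (use \<delta> in \<open>auto simp: P_def\<close>)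
  also have "(\<delta> / 2)\<^sup>2 / (4104 * \<tau>\<^sup>2 * card P) = \<delta>\<^sup>2 * (real M * (real l)\<^sup>2 / real D) / (16416 * b\<^sup>2)"
    using pos b by (simp add: \<tau>_def cP field_simps power2_eq_square)
  finally show ?thesis
    unfolding ex P_def .
qed

text \<open>The event quantifies over uncountably many \<open>z\<close>, so countable intersections
  do not suffice directly. Each inequality is a closed condition on the entries, and arbitrary
  intersections of closed sets are closed. A non-measurable event would have \<open>prob\<close> 0
  by default.\<close>

lemma model_RIP_W_sets:
  "{\<omega> \<in> space N. model_RIP (transpose_mat (W \<omega>)) S \<delta>} \<in> sets N"
  if S: "S \<subseteq> carrier_vec (K * n)"
proof -
  define E where "E = {..<K} \<times> {..<M} \<times> {..<l}"
  \<comment> \<open>Outside \<open>E\<close> nothing is known about \<open>X\<close>; the value 0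
    there makes the whole family measurable into the product space.\<close>
  define Y where "Y \<omega> e = (if e \<in> E then X e \<omega> else 0)" for \<omega> e
  define V where "V x r c = (if (r mod n) * t \<le> c mod D \<and> c mod D < (r mod n) * t + l
    then x (r div n, c div D, c mod D - (r mod n) * t) / sqrt (real M * real l) else 0)"
    for x :: "nat \<times> nat \<times> nat \<Rightarrow> real" and r c
  define G where "G x z = (\<Sum>c<M * D. (\<Sum>r<K * n. V x r c * vec_index z r)\<^sup>2)" for x z
  have Y: "Y \<in> borel_measurable N"
  proof (rule measurable_coordinatewise_then_product)
    show "(\<lambda>\<omega>. Y \<omega> e) \<in> borel_measurable N" for e
      by (cases "e \<in> E") (auto simp: Y_def E_def X_measurable)
  qed
  have contV: "continuous_on UNIV (\<lambda>x. V x r c)" for r c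
    unfolding V_def by (cases "(r mod n) * t \<le> c mod D \<and> c mod D < (r mod n) * t + l")
      (use pos in \<open>auto intro!: continuous_intros\<close>)
  have contG: "continuous_on UNIV (\<lambda>x. G x z)" for z
    unfolding G_def by (intro continuous_intros contV)
  have G: "(norm2 (transpose_mat (W \<omega>) *\<^sub>v z))\<^sup>2 = G (Y \<omega>) z" if z: "z \<in> S" for \<omega> z
  proof -
    have "W \<omega> $$ (r, c) = V (Y \<omega>) r c" if "r < K * n" "c < M * D" for r c
    proof -
      have d: "r div n < K" "c div D < M" using that by (auto simp: less_mult_imp_div_less)
      have "(r div n, c div D, c mod D - (r mod n) * t) \<in> E" if "c mod D < (r mod n) * t + l"
        unfolding E_def using d that pos(3) by (intro SigmaI lessThan_iff[THEN iffD2]) linarith+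
      then show ?thesis by (simp add: W_index[OF that] V_def Y_def)
    qed
    then show ?thesis
      using z S by (subst norm2_transpose_mult_sq) (auto simp: G_def)
  qed
  define F where "F = (\<Inter>z\<in>S. {x. (1 - \<delta>) * (norm2 z)\<^sup>2 \<le> G x z} \<inter> {x. G x z \<le> (1 + \<delta>) * (norm2 z)\<^sup>2})"
  have "closed F"
    unfolding F_def by (intro closed_INT ballI closed_Int closed_Collect_le contG continuous_on_const)
  then have "F \<in> sets borel" by simp
  then have "Y -` F \<inter> space N \<in> sets N" using Y by (rule measurable_sets[rotated])
  moreover have "{\<omega> \<in> space N. model_RIP (transpose_mat (W \<omega>)) S \<delta>} = Y -` F \<inter> space N"
    by (auto simp: model_RIP_def F_def G)
  ultimately show ?thesis by simp
qed

lemma model_RIP_W_prob: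
  assumes k: "0 < k" and \<delta>: "0 < \<delta>" "\<delta> < 1"
  shows "prob {\<omega> \<in> space N. model_RIP (transpose_mat (W \<omega>)) (model_sparse K n k) \<delta>}
    \<ge> 1 - real (K * n) ^ k * (3 * 2 ^ 16) ^ k
        * (2 * exp (- (\<delta>\<^sup>2 * (real M * (real l)\<^sup>2 / real D) / (16416 * b\<^sup>2))))"
proof -
  define p where "p = 2 * exp (- (\<delta>\<^sup>2 * (real M * (real l)\<^sup>2 / real D) / (16416 * b\<^sup>2)))"
  define L where "L = Sigma (model_supports K n k) (\<lambda>T. grid_points T k)"
  \<comment> \<open>The event ignores the support. A grid function may be counted for several
    supports, which is harmless in an upper bound.\<close>
  define bad where "bad = (\<lambda>(T :: nat set, a). {\<omega> \<in> space N.
    \<delta> / 2 \<le> \<bar>excess (W \<omega>) (\<lambda>r. of_int (a r) / (4 * sqrt (real k)))\<bar>})"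
  define good where "good = {\<omega> \<in> space N. model_RIP (transpose_mat (W \<omega>)) (model_sparse K n k) \<delta>}"
  have good: "good \<in> sets N"
    unfolding good_def by (rule model_RIP_W_sets) (auto simp: model_sparse_def)
  have T: "finite T" "card T \<le> k" "T \<subseteq> {..<K * n}" if "T \<in> model_supports K n k" for T
    using that finite_subset[of T "{..<K * n}"] by (auto simp: model_supports_def)
  have finL: "finite L"
    unfolding L_def by (intro finite_SigmaI card_model_supports card_grid_points T)
  have cardL: "real (card L) \<le> real (K * n) ^ k * (3 * 2 ^ 16) ^ k"
  proof -
    have "real (card L) = (\<Sum>T\<in>model_supports K n k. real (card (grid_points T k)))"
      unfolding L_def by (subst card_SigmaI) (auto intro: card_model_supports card_grid_points T)
    also have "\<dots> \<le> (\<Sum>T\<in>model_supports K n k. (3 * 2 ^ 16) ^ k)"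
      by (intro sum_mono card_grid_points T)
    also have "\<dots> = real (card (model_supports K n k)) * (3 * 2 ^ 16) ^ k" by simp
    also have "\<dots> \<le> real ((K * n) ^ k) * (3 * 2 ^ 16) ^ k"
      using card_model_supports(2)[of K n k] by (intro mult_right_mono) (simp_all only: of_nat_le_iff, simp)
    finally show ?thesis by simp
  qed
  have badset: "bad x \<in> sets N" for x
    unfolding bad_def by (cases x) simp
  have badprob: "prob (bad x) \<le> p" if "x \<in> L" for x
  proof -
    obtain U a where x: "x = (U, a)" "U \<in> model_supports K n k" "a \<in> grid_points U k"
      using \<open>x \<in> L\<close> by (auto simp: L_def)
    define v where "v r = of_int (a r) / (4 * sqrt (real k))" for r
    have v0: "v r = 0" if "r \<notin> U" for r
      using x(3) that by (simp add: v_def grid_points_def)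
    have "(\<Sum>r<K * n. (v r)\<^sup>2) = (\<Sum>r\<in>U. (v r)\<^sup>2)"
      using T(3)[OF x(2)] v0 by (intro sum.mono_neutral_right) auto
    also have "\<dots> = real_of_int (\<Sum>r\<in>U. (a r)\<^sup>2) / (16 * real k)"
      by (simp add: v_def power_divide power_mult_distrib sum_divide_distrib)
    also have "\<dots> \<le> real_of_int (16 * int k) / (16 * real k)"
    proof (rule divide_right_mono)
      show "real_of_int (\<Sum>r\<in>U. (a r)\<^sup>2) \<le> real_of_int (16 * int k)"
        unfolding of_int_le_iff using x(3) by (simp add: grid_points_def)
    qed simp
    also have "\<dots> = 1" using k by simp
    finally have v1: "(\<Sum>r<K * n. (v r)\<^sup>2) \<le> 1" .
    have "card {j. j < n \<and> v (i * n + j) \<noteq> 0} \<le> 1" if "i < K" for i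
    proof -
      have "card {j. j < n \<and> v (i * n + j) \<noteq> 0} \<le> card {j. j < n \<and> i * n + j \<in> U}"
        using v0 by (intro card_mono) auto
      also have "\<dots> \<le> 1" using x(2) that by (simp add: model_supports_def)
      finally show ?thesis .
    qed
    then show ?thesis
      using excess_W_tail[OF _ v1 \<delta>] by (simp add: bad_def x(1) v_def p_def)
  qed
  have "space N - (\<Union>x\<in>L. bad x) \<subseteq> good"
  proof
    fix \<omega> assume \<omega>: "\<omega> \<in> space N - (\<Union>x\<in>L. bad x)"
    have "model_RIP (transpose_mat (W \<omega>)) (model_sparse K n k) \<delta>"
    proof (rule model_RIP_if_grid)
      show "W \<omega> \<in> carrier_mat (K * n) (M * D)" by (intro carrier_matI) simp_all
      fix U a assume "U \<in> model_supports K n k" "a \<in> grid_points U k"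
      then have "(U, a) \<in> L" by (simp add: L_def)
      then have "\<omega> \<notin> bad (U, a)" using \<omega> by blast
      then show "\<bar>excess (W \<omega>) (\<lambda>r. of_int (a r) / (4 * sqrt (real k)))\<bar> \<le> \<delta> / 2"
        using \<omega> by (simp add: bad_def)
    qed (rule k)
    then show "\<omega> \<in> good" using \<omega> by (simp add: good_def)
  qed
  then have "prob (space N - (\<Union>x\<in>L. bad x)) \<le> prob good"
    using good by (rule finite_measure_mono)
  moreover have "prob (space N - (\<Union>x\<in>L. bad x)) = 1 - prob (\<Union>x\<in>L. bad x)"
    using badset finL by (intro prob_compl sets.finite_UN) auto
  moreover have "prob (\<Union>x\<in>L. bad x) \<le> (\<Sum>x\<in>L. prob (bad x))"
    using badset finL by (intro finite_measure_subadditive_finite) auto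
  moreover have "(\<Sum>x\<in>L. prob (bad x)) \<le> real (card L) * p"
    using sum_bounded_above[of L "\<lambda>x. prob (bad x)" p] badprob by simp
  moreover have "real (card L) * p \<le> real (K * n) ^ k * (3 * 2 ^ 16) ^ k * p"
    using cardL by (intro mult_right_mono) (auto simp: p_def)
  ultimately show ?thesis unfolding good_def p_def by linarith
qed

end

section \<open>The constant, and the case of a single entry\<close>

lemma union_bound_arith:
  fixes L \<epsilon> x b :: real and k N :: nat
  assumes N: "2 \<le> N" and k: "0 < k" and \<epsilon>: "0 < \<epsilon>" "\<epsilon> < 1" and b: "1 \<le> b"
    and x: "344736 * b\<^sup>2 * (real k * ln (real N) - ln \<epsilon>) \<le> x"
  shows "real N ^ k * (3 * 2 ^ 16) ^ k * (2 * exp (- (x / (16416 * b\<^sup>2)))) \<le> \<epsilon>"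
proof -
  define y where "y = real k * ln (real N)"
  have N0: "0 < real N" using N by simp
  have ky: "real k * ln 2 \<le> y"
    unfolding y_def using N by (intro mult_left_mono) auto
  have k1: "ln 2 \<le> real k * ln (2::real)"
    using k mult_right_mono[of 1 "real k" "ln (2::real)"] by simp
  have y0: "0 < y" using ky k1 ln_gt_zero[of "2::real"] by linarith
  have e0: "ln \<epsilon> < 0" using \<epsilon> by simp
  have "(3 * 2 ^ 16 :: real) ^ k \<le> (2 ^ 18) ^ k" by (intro power_mono) auto
  also have "\<dots> = exp (18 * (real k * ln 2))"
  proof -
    have "exp (18 * (real k * ln 2)) = exp (real (18 * k) * ln 2)" by (simp add: mult.assoc)
    also have "\<dots> = 2 ^ (18 * k)" by (simp only: exp_of_nat_mult) simp
    finally show ?thesis by (simp only: power_mult)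
  qed
  finally have 1: "(3 * 2 ^ 16 :: real) ^ k \<le> exp (18 * (real k * ln 2))" .
  have 2: "real N ^ k = exp y"
    unfolding y_def exp_of_nat_mult using N0 by simp
  have 3: "(2::real) = exp (ln 2)" by simp
  \<comment> \<open>\<open>344736 = 21 * 16416\<close>. Since \<open>N \<ge> 2\<close>, both
    \<open>k * ln 2\<close> and \<open>ln 2\<close> are at most \<open>y\<close>. Bounding
    \<open>3 * 2 ^ 16\<close> by \<open>2 ^ 18\<close>, supports, grid and the factor 2 cost
    \<open>y + 18 * y + y = 20 * y\<close>, and \<open>w\<close> offers
    \<open>21 * (y - ln \<epsilon>)\<close>.\<close>
  define w a where "w = x / (16416 * b\<^sup>2)" and "a = real k * ln 2"
  have "21 * (y - ln \<epsilon>) \<le> w"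
    using x b unfolding y_def w_def by (simp add: field_simps)
  moreover have "y + 18 * a + ln 2 \<le> 20 * y"
    using ky k1 unfolding a_def by linarith
  ultimately have "y + 18 * a + (ln 2 - w) \<le> ln \<epsilon>"
    using y0 e0 by (simp add: algebra_simps)
  then have "y + 18 * (real k * ln 2) + (ln 2 - x / (16416 * b\<^sup>2)) \<le> ln \<epsilon>"
    unfolding w_def a_def .
  then have "exp (y + 18 * (real k * ln 2) + (ln 2 - x / (16416 * b\<^sup>2))) \<le> \<epsilon>"
    using \<epsilon> by (metis exp_le_cancel_iff exp_ln)
  moreover have "real N ^ k * (3 * 2 ^ 16) ^ k * (2 * exp (- (x / (16416 * b\<^sup>2))))
      \<le> exp y * exp (18 * (real k * ln 2)) * (2 * exp (- (x / (16416 * b\<^sup>2))))"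
    unfolding 2 using 1 by (intro mult_right_mono mult_left_mono) auto
  ultimately show ?thesis by (simp add: exp_add exp_diff exp_minus field_simps)
qed

lemma (in cnn_sample) model_RIP_W_general:
  assumes "2 \<le> K * n" "0 < k" "0 < \<delta>" "\<delta> < 1" "0 < \<epsilon>" "\<epsilon> < 1"
    and C: "344736 * b\<^sup>2 \<le> C"
    and bound: "real M * (real l)\<^sup>2 / real D \<ge> C / \<delta>\<^sup>2 * (real k * (ln (real K) + ln (real n)) - ln \<epsilon>)"
  shows "prob {\<omega> \<in> space N. model_RIP (transpose_mat (W \<omega>)) (model_sparse K n k) \<delta>} \<ge> 1 - \<epsilon>"
proof -
  define q where "q = real k * (ln (real K) + ln (real n)) - ln \<epsilon>"
  have lnKn: "ln (real K) + ln (real n) = ln (real (K * n))"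
    using pos by (simp add: ln_mult)
  have "0 \<le> real k * (ln (real K) + ln (real n))" using pos by simp
  moreover have "ln \<epsilon> < 0" using assms by simp
  ultimately have q0: "0 \<le> q" by (simp add: q_def)
  have "344736 * b\<^sup>2 * q \<le> C * q" using C q0 by (rule mult_right_mono)
  also have "\<dots> = \<delta>\<^sup>2 * (C / \<delta>\<^sup>2 * q)" using assms by simp
  also have "\<dots> \<le> \<delta>\<^sup>2 * (real M * (real l)\<^sup>2 / real D)"
    using bound unfolding q_def by (rule mult_left_mono) simp
  finally have "real (K * n) ^ k * (3 * 2 ^ 16) ^ k
      * (2 * exp (- (\<delta>\<^sup>2 * (real M * (real l)\<^sup>2 / real D) / (16416 * b\<^sup>2)))) \<le> \<epsilon>"
    using assms b unfolding q_def lnKn by (intro union_bound_arith) auto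
  then show ?thesis using model_RIP_W_prob[of k \<delta>] assms by linarith
qed

text \<open>On this interval \<open>x\<^sup>2 / 2 \<le> 8 / 9 < 1\<close>, so the density exceeds
  \<open>exp (- 1) / sqrt (2 * pi)\<close>. The length \<open>\<delta> / 3\<close> is chosen so that
  squares of its points stay in \<open>[1, 1 + \<delta>]\<close>.\<close>

lemma std_normal_interval_ge:
  assumes "\<mu> = density lborel std_normal_density" and \<delta>: "0 < \<delta>" "\<delta> < 1"
  shows "measure \<mu> {1..1 + \<delta> / 3} \<ge> \<delta> / (3 * exp 1 * sqrt (2 * pi))"
proof -
  interpret prob_space \<mu> unfolding assms(1) by (rule prob_space_normal_density) simp
  define c where "c = 1 / (exp 1 * sqrt (2 * pi))"
  have dens: "c \<le> std_normal_density x" if "x \<in> {1..1 + \<delta> / 3}" for x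
  proof -
    have "x\<^sup>2 \<le> (4 / 3)\<^sup>2" using that \<delta> by (intro power_mono) auto
    then have "exp (- 1) \<le> exp (- x\<^sup>2 / 2)" by (simp add: power2_eq_square)
    then show ?thesis
      unfolding std_normal_density_def c_def by (simp add: exp_minus field_simps)
  qed
  have "ennreal (c * (\<delta> / 3)) = ennreal c * emeasure lborel {1..1 + \<delta> / 3}"
    by (subst ennreal_mult'') (use \<delta> in auto)
  also have "\<dots> = (\<integral>\<^sup>+x. ennreal c * indicator {1..1 + \<delta> / 3} x \<partial>lborel)"
    by (rule nn_integral_cmult_indicator[symmetric]) simp
  also have "\<dots> \<le> (\<integral>\<^sup>+x. ennreal (std_normal_density x) * indicator {1..1 + \<delta> / 3} x \<partial>lborel)"
    by (intro nn_integral_mono) (auto simp: indicator_def intro!: ennreal_leI dens)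
  also have "\<dots> = emeasure \<mu> {1..1 + \<delta> / 3}"
    unfolding assms(1) by (rule emeasure_density[symmetric]) auto
  finally have "c * (\<delta> / 3) \<le> measure \<mu> {1..1 + \<delta> / 3}"
    by (simp add: emeasure_eq_measure)
  then show ?thesis by (simp add: c_def)
qed

text \<open>With \<open>K = n = k = 1\<close> the logarithms vanish, so the hypothesis does not absorb the
  constants of the union bound; there \<open>W\<close> is a single Gaussian entry.\<close>

lemma (in cnn_sample) model_RIP_W_single:
  assumes Kn: "K * n < 2" and MD: "M * D \<le> K * n"
    and k: "k \<le> K" and \<delta>: "0 < \<delta>" "\<delta> < 1" and \<epsilon>: "0 < \<epsilon>" "\<epsilon> < 1"
    and normal: "distr N borel (X (0, 0, 0)) = density lborel std_normal_density"
    and C: "3 * exp 1 * sqrt (2 * pi) \<le> C"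
    and bound: "real M * (real l)\<^sup>2 / real D \<ge> C / \<delta>\<^sup>2 * (real k * (ln (real K) + ln (real n)) - ln \<epsilon>)"
  shows "prob {\<omega> \<in> space N. model_RIP (transpose_mat (W \<omega>)) (model_sparse K n k) \<delta>} \<ge> 1 - \<epsilon>"
proof -
  have "0 < K * n" "0 < M * D" using pos by auto
  then have Kn1: "K * n = 1" and MD1: "M * D = 1" using Kn MD by linarith+
  then have one: "K = 1" "n = 1" "M = 1" "D = 1" by auto
  then have l1: "l = 1" using pos by simp
  define C0 where "C0 = 3 * exp 1 * sqrt (2 * pi)"
  have C0: "0 < C0" by (simp add: C0_def)
  \<comment> \<open>The hypothesis now reads
    \<open>C * (- ln \<epsilon>) \<le> \<delta>\<^sup>2\<close>. It forces \<open>\<epsilon>\<close>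
    so close to 1 that the required probability \<open>1 - \<epsilon>\<close> is at most the small
    mass near 1.\<close>
  have "C0 * (- ln \<epsilon>) \<le> C * (- ln \<epsilon>)"
    using C \<epsilon> by (intro mult_right_mono) (auto simp: C0_def)
  also have "\<dots> \<le> \<delta>\<^sup>2"
    using bound \<delta> by (simp add: one l1 field_simps)
  also have "\<dots> \<le> \<delta>" using \<delta> by (simp add: power2_eq_square mult_left_le)
  finally have "- ln \<epsilon> \<le> \<delta> / C0" using C0 by (simp add: field_simps)
  moreover have "1 - \<epsilon> \<le> - ln \<epsilon>" using ln_le_minus_one[OF \<epsilon>(1)] by simp
  ultimately have "1 - \<epsilon> \<le> \<delta> / C0" by simp
  also have "\<dots> \<le> measure (distr N borel (X (0, 0, 0))) {1..1 + \<delta> / 3}"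
    unfolding C0_def by (rule std_normal_interval_ge[OF normal \<delta>])
  also have "\<dots> = prob (X (0, 0, 0) -` {1..1 + \<delta> / 3} \<inter> space N)"
    by (rule measure_distr) (auto intro!: X_measurable simp: one l1)
  also have "\<dots> \<le> prob {\<omega> \<in> space N. model_RIP (transpose_mat (W \<omega>)) (model_sparse K n k) \<delta>}"
  proof (rule finite_measure_mono)
    show "X (0, 0, 0) -` {1..1 + \<delta> / 3} \<inter> space N
        \<subseteq> {\<omega> \<in> space N. model_RIP (transpose_mat (W \<omega>)) (model_sparse K n k) \<delta>}"
    proof
      fix \<omega> assume "\<omega> \<in> X (0, 0, 0) -` {1..1 + \<delta> / 3} \<inter> space N"
      then have \<omega>: "\<omega> \<in> space N" "1 \<le> X (0, 0, 0) \<omega>" "X (0, 0, 0) \<omega> \<le> 1 + \<delta> / 3" by auto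
      define x where "x = (X (0, 0, 0) \<omega>)\<^sup>2"
      have "x \<le> (1 + \<delta> / 3)\<^sup>2" unfolding x_def using \<omega> by (intro power_mono) auto
      also have "\<dots> \<le> 1 + \<delta>"
        using \<delta> mult_left_mono[of \<delta> 1 \<delta>] by (simp add: power2_eq_square field_simps)
      finally have x1: "x \<le> 1 + \<delta>" .
      have x0: "1 - \<delta> \<le> x"
        using one_le_power[OF \<omega>(2), of 2] \<delta> unfolding x_def by linarith
      have W00: "W \<omega> $$ (0, 0) = X (0, 0, 0) \<omega>"
        by (subst W_index) (auto simp: one l1)
      have sq: "(norm2 (transpose_mat (W \<omega>) *\<^sub>v z))\<^sup>2 = x * (norm2 z)\<^sup>2"
        if "z \<in> carrier_vec (K * n)" for z
      proof -
        have "(norm2 (transpose_mat (W \<omega>) *\<^sub>v z))\<^sup>2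
            = (\<Sum>c<1. (\<Sum>r<1. W \<omega> $$ (r, c) * vec_index z r)\<^sup>2)"
          using norm2_transpose_mult_sq[of z "W \<omega>"] that unfolding W_dim Kn1 MD1 .
        also have "\<dots> = x * (vec_index z 0)\<^sup>2"
          by (simp add: W00 x_def power_mult_distrib)
        also have "(vec_index z 0)\<^sup>2 = (norm2 z)\<^sup>2"
          using that unfolding norm2_sq Kn1 by simp
        finally show ?thesis .
      qed
      have "model_RIP (transpose_mat (W \<omega>)) (model_sparse K n k) \<delta>"
        unfolding model_RIP_def
        using x0 x1 by (auto simp: model_sparse_def sq intro!: mult_right_mono)
      then show "\<omega> \<in> {\<omega> \<in> space N. model_RIP (transpose_mat (W \<omega>)) (model_sparse K n k) \<delta>}"
        using \<omega> by simp
    qed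
  qed (intro model_RIP_W_sets, auto simp: model_sparse_def)
  finally show ?thesis .
qed

theorem theorem3p1:
  fixes \<mu> :: "real measure"
  assumes "prob_space \<mu>" and "sets \<mu> = sets borel"
    and "sub_gaussian \<mu> (\<lambda>x. x)"
    and "prob_space.variance \<mu> (\<lambda>x. x) = 1"
  shows "\<exists>C>0. \<forall>(M::nat) (K::nat) (l::nat) (D::nat) (t::nat) (k::nat) (n::nat)
           (\<delta>::real) (\<epsilon>::real) (\<Omega> :: 'a measure) (X :: nat \<times> nat \<times> nat \<Rightarrow> 'a \<Rightarrow> real).
           0 < M \<longrightarrow> 0 < K \<longrightarrow> 0 < l \<longrightarrow> 0 < D \<longrightarrow> 0 < t \<longrightarrow> 0 < k \<longrightarrow>
           l \<le> D \<longrightarrow> k \<le> K \<longrightarrow>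
           real n = (real D - real l) / real t + 1 \<longrightarrow>
           M * D \<le> K * n \<longrightarrow>
           (2 \<le> K * n \<or> \<mu> = density lborel std_normal_density) \<longrightarrow>
           0 < \<delta> \<longrightarrow> \<delta> < 1 \<longrightarrow> 0 < \<epsilon> \<longrightarrow> \<epsilon> < 1 \<longrightarrow>
           prob_space \<Omega> \<longrightarrow>
           prob_space.indep_vars \<Omega> (\<lambda>_. borel) X ({..<K} \<times> {..<M} \<times> {..<l}) \<longrightarrow>
           (\<forall>a \<in> {..<K} \<times> {..<M} \<times> {..<l}. distr \<Omega> borel (X a) = \<mu>) \<longrightarrow>
           real M * (real l)\<^sup>2 / real D
             \<ge> C / \<delta>\<^sup>2 * (real k * (ln (real K) + ln (real n)) - ln \<epsilon>) \<longrightarrow>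
           measure \<Omega>
             {\<omega> \<in> space \<Omega>.
                model_RIP
                  (transpose_mat
                    (cnn_weight_matrix M K l D t n
                      (\<lambda>i m p. X (i, m, p) \<omega> / sqrt (real M * real l))))
                  (model_sparse K n k) \<delta>}
             \<ge> 1 - \<epsilon>"
proof -
  interpret \<mu>: prob_space \<mu> by (rule assms(1))
  obtain c where c: "\<And>s. integrable \<mu> (\<lambda>x. exp (s * x))"
      "\<And>s. (\<integral>x. exp (s * x) \<partial>\<mu>) \<le> exp (s\<^sup>2 * c\<^sup>2)"
    and mean: "integrable \<mu> (\<lambda>x. x)" "(\<integral>x. x \<partial>\<mu>) = 0"
    using assms(3) unfolding sub_gaussian_def by blast
  have var: "(\<integral>x. x\<^sup>2 \<partial>\<mu>) = 1" using assms(4) mean by simp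
  \<comment> \<open>The Bochner integral of a non-integrable function is 0, so a second moment equal
    to 1 already entails integrability.\<close>
  then have var_int: "integrable \<mu> (\<lambda>x. x\<^sup>2)"
    using not_integrable_integral_eq by force
  \<comment> \<open>Enlarging the proxy preserves the mgf bound and supplies
    \<open>1 \<le> b\<close>, which the second moment comparison requires.\<close>
  define b where "b = max 1 (c\<^sup>2)"
  have mgf: "(\<integral>x. exp (s * x) \<partial>\<mu>) \<le> exp (s\<^sup>2 * b)" for s
  proof -
    have "s\<^sup>2 * c\<^sup>2 \<le> s\<^sup>2 * b" by (intro mult_left_mono) (auto simp: b_def)
    then show ?thesis using c(2)[of s] by (meson exp_le_cancel_iff order_trans)
  qed
  \<comment> \<open>The two constants serve \<open>K * n \<ge> 2\<close> and
    \<open>K * n = 1\<close> respectively; both depend on \<open>\<mu>\<close> at most through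
    \<open>b\<close>.\<close>
  define C where "C = max (344736 * b\<^sup>2) (3 * exp 1 * sqrt (2 * pi))"
  show ?thesis
  proof (intro exI[of _ C] conjI allI impI)
    show "0 < C" by (simp add: C_def less_max_iff_disj)
    fix M K l D t k n :: nat and \<delta> \<epsilon> :: real and \<Omega> :: "'a measure"
      and X :: "nat \<times> nat \<times> nat \<Rightarrow> 'a \<Rightarrow> real"
    assume params: "0 < M" "0 < K" "0 < l" "0 < D" "0 < t" "0 < k" "l \<le> D" "k \<le> K"
      and n: "real n = (real D - real l) / real t + 1"
      and MD: "M * D \<le> K * n"
      and cases: "2 \<le> K * n \<or> \<mu> = density lborel std_normal_density"
      and \<delta>: "0 < \<delta>" "\<delta> < 1" and \<epsilon>: "0 < \<epsilon>" "\<epsilon> < 1"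
      and \<Omega>: "prob_space \<Omega>"
      and ind: "prob_space.indep_vars \<Omega> (\<lambda>_. borel) X ({..<K} \<times> {..<M} \<times> {..<l})"
      and distr: "\<forall>a \<in> {..<K} \<times> {..<M} \<times> {..<l}. distr \<Omega> borel (X a) = \<mu>"
      and bound: "real M * (real l)\<^sup>2 / real D
             \<ge> C / \<delta>\<^sup>2 * (real k * (ln (real K) + ln (real n)) - ln \<epsilon>)"
    interpret \<Omega>: prob_space \<Omega> by (rule \<Omega>)
    have "0 \<le> (real D - real l) / real t" using params by simp
    then have "1 \<le> real n" using n by linarith
    then have n0: "0 < n" by simp
    \<comment> \<open>The equation for \<open>n\<close> says that the last shift ends exactly at
      \<open>D\<close>; \<open>0 < n\<close> makes the natural-number subtraction
      \<open>n - 1\<close> exact.\<close>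
    have "(real n - 1) * real t = real D - real l" unfolding n using params by simp
    then have "real ((n - 1) * t + l) = real D"
      using n0 by (simp add: of_nat_diff Suc_leI)
    then have fit: "(n - 1) * t + l \<le> D" unfolding of_nat_eq_iff by simp
    have Xm: "X e \<in> borel_measurable \<Omega>" if "e \<in> {..<K} \<times> {..<M} \<times> {..<l}" for e
      using ind that unfolding \<Omega>.indep_vars_def2 by auto
    have transfer: "integrable \<Omega> (\<lambda>\<omega>. f (X e \<omega>)) \<and> (\<integral>\<omega>. f (X e \<omega>) \<partial>\<Omega>) = (\<integral>x. f x \<partial>\<mu>)"
      if e: "e \<in> {..<K} \<times> {..<M} \<times> {..<l}" and f: "integrable \<mu> f" "f \<in> borel_measurable borel"
      for e and f :: "real \<Rightarrow> real"
      using f integrable_distr_eq[OF Xm[OF e] f(2)] integral_distr[OF Xm[OF e] f(2)]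
      by (simp add: distr[rule_format, OF e])
    have id: "integrable \<Omega> (X e) \<and> \<Omega>.expectation (X e) = 0"
      if "e \<in> {..<K} \<times> {..<M} \<times> {..<l}" for e
      using transfer[OF that mean(1) measurable_ident_sets[OF refl, unfolded id_def]] mean(2) by simp
    have sq: "integrable \<Omega> (\<lambda>\<omega>. (X e \<omega>)\<^sup>2) \<and> \<Omega>.expectation (\<lambda>\<omega>. (X e \<omega>)\<^sup>2) = 1"
      if "e \<in> {..<K} \<times> {..<M} \<times> {..<l}" for e
      using transfer[OF that var_int] var by simp
    have exp: "integrable \<Omega> (\<lambda>\<omega>. exp (s * X e \<omega>)) \<and> \<Omega>.expectation (\<lambda>\<omega>. exp (s * X e \<omega>)) \<le> exp (s\<^sup>2 * b)"
      if "e \<in> {..<K} \<times> {..<M} \<times> {..<l}" for e s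
      using transfer[OF that c(1)[of s]] mgf[of s] by simp
    interpret cnn_sample \<Omega> M K l D t n b X
      by unfold_locales (use params n0 fit ind id sq exp in \<open>simp_all add: b_def\<close>)
    have "\<Omega>.prob {\<omega> \<in> space \<Omega>. model_RIP (transpose_mat (W \<omega>)) (model_sparse K n k) \<delta>} \<ge> 1 - \<epsilon>"
    proof (cases "2 \<le> K * n")
      case True
      then show ?thesis
        by (rule model_RIP_W_general[OF _ params(6) \<delta> \<epsilon> _ bound]) (simp add: C_def)
    next
      case False
      have "distr \<Omega> borel (X (0, 0, 0)) = density lborel std_normal_density"
        using distr cases False params by auto
      then show ?thesis
        using False by (intro model_RIP_W_single[OF _ MD params(8) \<delta> \<epsilon> _ _ bound]) (auto simp: C_def)
    qed
    then show "1 - \<epsilon> \<le> measure \<Omega> {\<omega> \<in> space \<Omega>. model_RIP (transpose_mat (cnn_weight_matrix M K l D t n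
        (\<lambda>i m p. X (i, m, p) \<omega> / sqrt (real M * real l)))) (model_sparse K n k) \<delta>}"
      by (simp add: W_def random_cnn_def)
  qed
qed

end
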